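(* Let $p,q>0$ and $t\ge 0$. Let $\mathcal{N}$ range over all (finite or infinite) networks for the Bass model with $p_j=p$ and $q_j=q$ for all $j\in\mathcal{M}$, where $q_j=\sum_{k\in\mathcal{M}}q_{k,j}$. Then $$\sup_{\mathcal{N}} f(t;\mathcal{N})=\sup_{\mathcal{N},\,m\in\mathcal{M}} f_m(t;\mathcal{N})=f_{\rm Bass}(t;p,q).$$
   Context: Bass model on a network. Let $\mathcal{M}=\{1,\dots,M\}$ be a set of individuals (nodes), where $M$ may be finite or infinite (if $M=\infty$, $\mathcal{M}=\{1,2,\dots\}$). $X_j(t)\in\{0,1\}$ is the state of $j$ at continuous time $t\ge 0$ ($1$ = adopter, $0$ = nonadopter), with $X_j(0)=0$ for all $j$. Each node $j$ has an external influence rate $p_j>0$, and each ordered pair $(k,j)$ has an internal influence rate $q_{k,j}\ge 0$ of $k$ on $j$, with $q_{k,j}>0$ iff there is a directed edge from $k$ to $j$, and $q_{j,j}=0$; symmetry $q_{k,j}=q_{j,k}$ is not assumed. Adopters remain adopters forever, and a nonadopter $j$ adopts at rate $\lambda_j(t)=p_j+\sum_{k\in\mathcal{M}}q_{k,j}X_k(t)$; i.e. as $\Delta t\to 0$, $\mathbb{P}(X_j(t+\Delta t)=1\mid \mathbf{X}(t))$ equals $1$ if $X_j(t)=1$ and $\big(p_j+\sum_{k\in\mathcal{M}}q_{k,j}X_k(t)\big)\Delta t$ if $X_j(t)=0$, where $\mathbf{X}(t)=(X_1(t),\dots,X_M(t))$. Set $q_j:=\sum_{k\in\mathcal{M}}q_{k,j}$;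 it is assumed that $q_j>0$ for all $j$. The network need not be connected. The network is denoted $\mathcal{N}=\mathcal{N}(\mathcal{M},\{p_k\},\{q_{k,j}\})$. Adoption probability of node $j$: $f_j(t;\mathcal{N}):=\mathbb{P}(X_j(t)=1)$. Expected adoption level: $f(t;\mathcal{N}):=\frac1M\sum_{j=1}^M f_j(t;\mathcal{N})$ if $M<\infty$, and $f(t;\mathcal{N}):=\lim_{M\to\infty}\frac1M\sum_{j=1}^M f_j(t;\mathcal{N})$ for infinite networks. Bass formula: $f_{\rm Bass}(t;p,q)=\dfrac{1-e^{-(p+q)t}}{1+\frac{q}{p}e^{-(p+q)t}}$. *)

theory Defs
  imports "HOL-Probability.Probability" "HOL-Library.Extended_Nat"
begin

section \<open>Networks\<close>

text \<open>
  \<open>int_rate N k j\<close> is the influence of \<open>k\<close> on \<open>j\<close>; there is an edge from \<open>k\<close> to \<open>j\<close> iff it is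
  positive. Rates involving indices outside \<open>nodes N\<close> are irrelevant.
\<close>

record network =
  num_nodes :: enat
  ext_rate :: "nat \<Rightarrow> real"
  int_rate :: "nat \<Rightarrow> nat \<Rightarrow> real"

definition nodes :: "network \<Rightarrow> nat set" where
  "nodes N = {j. 1 \<le> j \<and> enat j \<le> num_nodes N}"

definition total_int_rate :: "network \<Rightarrow> nat \<Rightarrow> real" where
  "total_int_rate N j = (\<Sum>\<^sub>\<infinity>k\<in>nodes N. int_rate N k j)"

definition bass_network :: "network \<Rightarrow> bool" where
  "bass_network N \<longleftrightarrow>
     1 \<le> num_nodes N \<and>
     (\<forall>j\<in>nodes N.
        0 < ext_rate N j \<and>
        (\<forall>k\<in>nodes N. 0 \<le> int_rate N k j) \<and>
        int_rate N j j = 0 \<and>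
        (\<lambda>k. int_rate N k j) summable_on nodes N \<and>
        0 < total_int_rate N j)"


section \<open>The Bass model\<close>

text \<open>\<open>X j t\<close> is the random state of node \<open>j\<close> at time \<open>t\<close>, with \<open>True\<close> for adopters.\<close>

definition adoption_rate ::
  "network \<Rightarrow> (nat \<Rightarrow> real \<Rightarrow> 'w \<Rightarrow> bool) \<Rightarrow> nat \<Rightarrow> real \<Rightarrow> 'w \<Rightarrow> real" where
  "adoption_rate N X j t \<omega> =
     ext_rate N j + (\<Sum>\<^sub>\<infinity>k\<in>nodes N. int_rate N k j * of_bool (X k t \<omega>))"

text \<open>
  The sigma-algebras generated by the configuration at time \<open>t\<close> and by the configurations
  at all times in \<open>[0, t]\<close>.
\<close>

definition state_algebra ::
  "network \<Rightarrow> 'w measure \<Rightarrow> (nat \<Rightarrow> real \<Rightarrow> 'w \<Rightarrow> bool) \<Rightarrow> real \<Rightarrow> 'w measure" where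
  "state_algebra N P X t = sigma (space P) {{\<omega> \<in> space P. X j t \<omega>} | j. j \<in> nodes N}"

definition history_algebra ::
  "network \<Rightarrow> 'w measure \<Rightarrow> (nat \<Rightarrow> real \<Rightarrow> 'w \<Rightarrow> bool) \<Rightarrow> real \<Rightarrow> 'w measure" where
  "history_algebra N P X t =
     sigma (space P) {{\<omega> \<in> space P. X j s \<omega>} | j s. j \<in> nodes N \<and> 0 \<le> s \<and> s \<le> t}"

abbreviation cond_prob_given :: "'w measure \<Rightarrow> 'w measure \<Rightarrow> 'w set \<Rightarrow> 'w \<Rightarrow> real" where
  "cond_prob_given P F A \<equiv> real_cond_exp P F (indicator A)"

text \<open>
  In \<open>adopts_at_rate\<close>, the conditional probability given the configuration at time \<open>t\<close>
  that a nonadopter \<open>j\<close> has adopted by time \<open>t + h\<close> is the rate times \<open>h\<close>, up to an error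
  \<open>\<epsilon> h * h\<close> that is \<open>o(h)\<close>. The error bound must not depend on \<open>t\<close> or on the
  configuration: an expansion that is only pointwise in \<open>t\<close> would admit adoptions with
  positive probability at a deterministic time, which have no rate.

  \<open>no_joint_adoption\<close> is the usual convention that nodes adopt one at a time. It is needed
  because the rates of the individual nodes alone do not determine the joint dynamics.
\<close>

locale bass_process = prob_space P for P :: "'w measure" +
  fixes N :: network and X :: "nat \<Rightarrow> real \<Rightarrow> 'w \<Rightarrow> bool"
  assumes network: "bass_network N"
    and random_state:
      "\<lbrakk>j \<in> nodes N; 0 \<le> t\<rbrakk> \<Longrightarrow> X j t \<in> measurable P (count_space UNIV)"
    and initially_nonadopter:
      "\<lbrakk>j \<in> nodes N; \<omega> \<in> space P\<rbrakk> \<Longrightarrow> \<not> X j 0 \<omega>"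
    and remains_adopter:
      "\<lbrakk>j \<in> nodes N; \<omega> \<in> space P; 0 \<le> s; s \<le> t; X j s \<omega>\<rbrakk> \<Longrightarrow> X j t \<omega>"
    and markov:
      "\<lbrakk>0 \<le> t; t \<le> u; A \<in> sets (state_algebra N P X u)\<rbrakk> \<Longrightarrow>
         AE \<omega> in P. cond_prob_given P (history_algebra N P X t) A \<omega>
                  = cond_prob_given P (state_algebra N P X t) A \<omega>"
    and adopts_at_rate:
      "j \<in> nodes N \<Longrightarrow>
         \<exists>\<epsilon>. (\<epsilon> \<longlongrightarrow> 0) (at_right 0) \<and>
           (\<forall>t\<ge>0. \<forall>h>0. AE \<omega> in P.
              let c = cond_prob_given P (state_algebra N P X t) {\<omega> \<in> space P. X j (t + h) \<omega>} \<omega>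
              in if X j t \<omega> then c = 1
                 else \<bar>c - adoption_rate N X j t \<omega> * h\<bar> \<le> \<epsilon> h * h)"
    and no_joint_adoption:
      "\<lbrakk>i \<in> nodes N; j \<in> nodes N; i \<noteq> j\<rbrakk> \<Longrightarrow>
         \<exists>\<epsilon>. (\<epsilon> \<longlongrightarrow> 0) (at_right 0) \<and>
           (\<forall>t\<ge>0. \<forall>h>0. AE \<omega> in P.
              \<not> X i t \<omega> \<and> \<not> X j t \<omega> \<longrightarrow>
              cond_prob_given P (state_algebra N P X t)
                {\<omega> \<in> space P. X i (t + h) \<omega> \<and> X j (t + h) \<omega>} \<omega> \<le> \<epsilon> h * h)"


section \<open>Adoption probabilities and levels\<close>

definition adoption_prob ::
  "'w measure \<Rightarrow> (nat \<Rightarrow> real \<Rightarrow> 'w \<Rightarrow> bool) \<Rightarrow> nat \<Rightarrow> real \<Rightarrow> real" where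
  "adoption_prob P X j t = measure P {\<omega> \<in> space P. X j t \<omega>}"

definition avg_adoption ::
  "'w measure \<Rightarrow> (nat \<Rightarrow> real \<Rightarrow> 'w \<Rightarrow> bool) \<Rightarrow> nat \<Rightarrow> real \<Rightarrow> real" where
  "avg_adoption P X n t = 1 / real n * (\<Sum>j=1..n. adoption_prob P X j t)"

definition adoption_level ::
  "network \<Rightarrow> 'w measure \<Rightarrow> (nat \<Rightarrow> real \<Rightarrow> 'w \<Rightarrow> bool) \<Rightarrow> real \<Rightarrow> real" where
  "adoption_level N P X t =
     (case num_nodes N of
        enat n \<Rightarrow> avg_adoption P X n t
      | \<infinity> \<Rightarrow> lim (\<lambda>n. avg_adoption P X n t))"

text \<open>On an infinite network the level is defined only if the limit of the averages exists.\<close>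

definition adoption_level_exists ::
  "network \<Rightarrow> 'w measure \<Rightarrow> (nat \<Rightarrow> real \<Rightarrow> 'w \<Rightarrow> bool) \<Rightarrow> real \<Rightarrow> bool" where
  "adoption_level_exists N P X t \<longleftrightarrow>
     (num_nodes N = \<infinity> \<longrightarrow> convergent (\<lambda>n. avg_adoption P X n t))"

definition f_Bass :: "real \<Rightarrow> real \<Rightarrow> real \<Rightarrow> real" where
  "f_Bass t p q = (1 - exp (- (p + q) * t)) / (1 + q / p * exp (- (p + q) * t))"


section \<open>Bass models with common rates\<close>

text \<open>
  To range over all networks is to range over all networks together with a Bass process
  on them. A set of such processes needs one fixed sample type; that of all trajectories
  loses no generality, since any Bass process on any sample type has the same law as the
  coordinate process \<open>X j t \<omega> = \<omega> t j\<close> on the set of monotone trajectories.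
\<close>

type_synonym trajectory = "real \<Rightarrow> nat \<Rightarrow> bool"

definition uniform_bass_models ::
  "real \<Rightarrow> real \<Rightarrow>
   (network \<times> trajectory measure \<times> (nat \<Rightarrow> real \<Rightarrow> trajectory \<Rightarrow> bool)) set" where
  "uniform_bass_models p q =
     {(N, P, X). bass_process P N X \<and>
        (\<forall>j\<in>nodes N. ext_rate N j = p \<and> total_int_rate N j = q)}"

end

theory Submission
  imports Defs
begin

text \<open>
  For a finite set \<open>S\<close> of \<open>n\<close> nodes let \<open>[S](t)\<close> be the probability that no node of \<open>S\<close> has
  adopted by time \<open>t\<close>. A first adoption in \<open>S\<close> destroys the event, so, formally,
  \<open>[S]' = - n (p + q) [S] + \<Sum>j\<in>S. \<Sum>k. q k j [S \<union> {k}]\<close>: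
  node \<open>j\<close> adopts at rate \<open>p + q\<close> less the influence of those \<open>k\<close> that have not adopted yet.
  On the other side, \<open>y = 1 - f_Bass\<close> solves \<open>y' = - (p + q) y + q y\<^sup>2\<close> with \<open>y 0 = 1\<close>, so
  \<open>y ^ n\<close> solves the same equation with \<open>y ^ (n + 1)\<close> in place of every \<open>[S \<union> {k}]\<close>.
  The Bass formula is thus what the hierarchy gives if \<open>k\<close> never belongs to \<open>S\<close> and nodes are
  independent.

  Upper bound. As \<open>y \<le> 1\<close>, the powers form a subsolution even where \<open>k \<in> S\<close>. If \<open>E\<close> bounds
  all differences \<open>y ^ n - [S]\<close>, then such a difference \<open>D\<close> satisfies
  \<open>D' \<le> - n (p + q) D + n q E\<close>, hence \<open>D \<le> q / (p + q) E\<close>. The factor is less than \<open>1\<close> and does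
  not depend on \<open>n\<close>, so iterating from the trivial bound \<open>E = 1\<close> gives \<open>[S] \<ge> y ^ n\<close> on all
  networks, finite or infinite (\<open>nonadoption_ge_contract\<close>, \<open>nonadoption_ge_power\<close>). For
  a singleton this says that adoption probabilities are at most \<open>f_Bass\<close>, and averages
  and limits of averages inherit the bound.

  Sharpness. If a single node influences another at rate at most \<open>\<kappa>\<close>, the terms with
  \<open>k \<in> S\<close> total at most \<open>n \<kappa>\<close> for each \<open>j\<close>, and the same contraction runs in the opposite
  direction with an additional error proportional to \<open>\<kappa>\<close> (\<open>nonadoption_le_contract\<close>,
  \<open>nonadoption_le_power\<close>). On the complete network with \<open>M\<close> nodes, \<open>\<kappa> = q / (M - 1)\<close> tends to
  \<open>0\<close>, and all adoption probabilities tend to \<open>f_Bass\<close>.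

  Existence. Both suprema range over processes, so a process on a finite network has to be
  produced (\<open>finite_network_has_process\<close>). The vector of adoption times is
  given its explicit density: each node contributes its hazard rate at its own adoption time
  times the exponential of minus its cumulative hazard. At any time the density factors into
  the density of the past adoptions, the probability that the others survive, and the
  density of a process started afresh (\<open>time_density_split\<close>). Fubini turns this into the Markov
  property, and integrating over small boxes gives the rates.
\<close>

section \<open>Comparison for approximate differential inequalities\<close>

text \<open>
  A Gronwall estimate along the grid of mesh \<open>t / n\<close>: the map \<open>d \<mapsto> d - h (a d - b - e)\<close> is monotone
  for \<open>h a \<le> 1\<close> and keeps \<open>(b + e) / a\<close> fixed. The assumption replaces the differential
  inequality \<open>D' \<le> - a D + b\<close>, so that neither differentiability nor continuity of \<open>D\<close> has to be
  established for the probabilities to which it is applied.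
\<close>

lemma discrete_comparison:
  fixes D :: "real \<Rightarrow> real"
  assumes a: "0 < a" and t: "0 \<le> t" and D0: "D 0 \<le> b / a"
    and step: "\<And>e. 0 < e \<Longrightarrow> \<forall>\<^sub>F h in at_right 0. \<forall>s\<in>{0..t}. D (s + h) \<le> D s - h * (a * D s - b - e)"
  shows "D t \<le> b / a"
proof (cases "t = 0")
  case False
  with t have t: "0 < t" by simp
  have *: "D t \<le> (b + e) / a" if e: "0 < e" for e
  proof -
    have "\<forall>\<^sub>F h in at_right (0::real). h < 1 / a"
      using a by (intro eventually_at_rightI[of 0 "1 / a"]) auto
    with step[OF e] have "\<forall>\<^sub>F h in at_right 0. h < 1 / a \<and> (\<forall>s\<in>{0..t}. D (s + h) \<le> D s - h * (a * D s - b - e))"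
      by eventually_elim auto
    moreover have "filterlim (\<lambda>n. t / real (Suc n)) (at_right 0) sequentially"
      unfolding filterlim_at
      using t LIMSEQ_Suc[OF lim_const_over_n[of t]] by (auto intro!: always_eventually)
    ultimately have "\<forall>\<^sub>F n in sequentially. t / real (Suc n) < 1 / a \<and>
        (\<forall>s\<in>{0..t}. D (s + t / real (Suc n)) \<le> D s - t / real (Suc n) * (a * D s - b - e))"
      by (rule eventually_compose_filterlim)
    then obtain n where h: "t / real (Suc n) < 1 / a"
      and D: "\<forall>s\<in>{0..t}. D (s + t / real (Suc n)) \<le> D s - t / real (Suc n) * (a * D s - b - e)"
      by (auto dest: eventually_happens)
    define h where "h = t / real (Suc n)"
    have hpos: "0 < h" "h * a \<le> 1" and hn: "h * real (Suc n) = t"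
      using t a h by (auto simp: h_def field_simps)
    have "D (real i * h) \<le> (b + e) / a" if "i \<le> Suc n" for i
      using that
    proof (induction i)
      case 0
      have "b / a \<le> (b + e) / a"
        using a e by (intro divide_right_mono) auto
      then show ?case using D0 by simp
    next
      case (Suc i)
      have "real i * h \<le> real (Suc n) * h"
        using Suc.prems hpos by (intro mult_right_mono) auto
      also have "\<dots> = t"
        using hn by (simp add: mult.commute)
      finally have "real i * h \<in> {0..t}"
        using hpos by simp
      then have "D (real i * h + h) \<le> D (real i * h) - h * (a * D (real i * h) - b - e)"
        using D unfolding h_def[symmetric] by blast
      moreover have "real (Suc i) * h = real i * h + h"
        by (simp add: algebra_simps)
      ultimately have "D (real (Suc i) * h) \<le> D (real i * h) - h * (a * D (real i * h) - b - e)"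
        by simp
      also have "\<dots> = (1 - h * a) * D (real i * h) + h * (b + e)"
        by (simp add: algebra_simps)
      also have "\<dots> \<le> (1 - h * a) * ((b + e) / a) + h * (b + e)"
        using Suc hpos by (intro add_right_mono mult_left_mono) auto
      also have "\<dots> = (b + e) / a"
        using a by (simp add: field_simps)
      finally show ?case .
    qed
    from this[of "Suc n"] show "D t \<le> (b + e) / a"
      using hn by (simp add: mult.commute)
  qed
  have "D t \<le> b / a + e" if "0 < e" for e
    using *[of "a * e"] a that by (simp add: add_divide_distrib)
  then show ?thesis
    by (rule field_le_epsilon)
qed (use D0 in simp)

text \<open>
  The mean value theorem and the uniform continuity of the derivative on a compact interval make
  the first-order expansion uniform in the base point, as the comparison requires.
\<close>

lemma uniform_expansion:
  fixes f :: "real \<Rightarrow> real"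
  assumes deriv: "\<And>s. (f has_real_derivative G s) (at s)" and cont: "continuous_on UNIV G" and e: "0 < e"
  shows "\<forall>\<^sub>F h in at_right 0. \<forall>s\<in>{0..t}. \<bar>f (s + h) - (f s + h * G s)\<bar> \<le> h * e"
proof -
  have "uniformly_continuous_on {0..t + 1} G"
    by (intro compact_uniformly_continuous continuous_on_subset[OF cont]) auto
  then obtain d where d: "0 < d" "\<And>x y. x \<in> {0..t + 1} \<Longrightarrow> y \<in> {0..t + 1} \<Longrightarrow> dist y x < d \<Longrightarrow> dist (G y) (G x) < e"
    unfolding uniformly_continuous_on_def using e by meson
  show ?thesis
  proof (rule eventually_at_rightI[of 0 "min d 1"], intro ballI)
    fix h s assume h: "h \<in> {0<..<min d 1}" and s: "s \<in> {0..t}"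
    obtain \<xi> where \<xi>: "s < \<xi>" "\<xi> < s + h" "f (s + h) - f s = (s + h - s) * G \<xi>"
      using MVT2[of s "s + h" f G] deriv h by auto
    have "\<bar>G \<xi> - G s\<bar> < e"
      using d(2)[of s \<xi>] h s \<xi> by (auto simp: dist_real_def)
    then have "h * \<bar>G \<xi> - G s\<bar> \<le> h * e"
      using h by (intro mult_left_mono) auto
    moreover have "f (s + h) - (f s + h * G s) = h * (G \<xi> - G s)"
      using \<xi> by (simp add: algebra_simps)
    ultimately show "\<bar>f (s + h) - (f s + h * G s)\<bar> \<le> h * e"
      using h by (simp add: abs_mult)
  qed (use d in auto)
qed

section \<open>The equation behind the Bass formula\<close>

definition bass_nonadoption :: "real \<Rightarrow> real \<Rightarrow> real \<Rightarrow> real" where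
  "bass_nonadoption p q t = 1 - f_Bass t p q"

lemma bass_nonadoption_eq:
  assumes "0 < p" "0 < q"
  shows "bass_nonadoption p q t = (p + q) * exp (- (p + q) * t) / (p + q * exp (- (p + q) * t))"
proof -
  define E where "E = exp (- (p + q) * t)"
  have "0 < p + q * E" "0 < 1 + q / p * E"
    using assms by (auto simp: E_def intro!: add_pos_pos)
  then show ?thesis
    using assms unfolding bass_nonadoption_def f_Bass_def E_def[symmetric] by (simp add: field_simps)
qed

lemma bass_nonadoption_0: "0 < p \<Longrightarrow> 0 < q \<Longrightarrow> bass_nonadoption p q 0 = 1"
  by (simp add: bass_nonadoption_eq)

lemma bass_nonadoption_bounds:
  assumes "0 < p" "0 < q" "0 \<le> t"
  shows "0 \<le> bass_nonadoption p q t" "bass_nonadoption p q t \<le> 1"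
proof -
  define E where "E = exp (- ((p + q) * t))"
  have E: "0 < E" "E \<le> 1"
    using mult_nonneg_nonneg[of "p + q" t] assms by (auto simp: E_def)
  then have pos: "0 < p + q * E"
    using assms by (intro add_pos_pos) auto
  have "p * E \<le> p * 1"
    using assms E by (intro mult_left_mono) auto
  then show "0 \<le> bass_nonadoption p q t" "bass_nonadoption p q t \<le> 1"
    using assms E pos unfolding bass_nonadoption_eq[OF assms(1,2)] mult_minus_left E_def[symmetric]
    by (auto simp: divide_le_eq_1 algebra_simps)
qed

text \<open>
  The Bass equation \<open>f' = (1 - f) (p + q f)\<close>, written for \<open>1 - f\<close>.
\<close>

lemma bass_nonadoption_deriv:
  assumes pq: "0 < p" "0 < q"
  shows "(bass_nonadoption p q has_real_derivative
     - (p + q) * bass_nonadoption p q t + q * (bass_nonadoption p q t)\<^sup>2) (at t)"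
proof -
  define E where "E t = exp (- (p + q) * t)" for t
  have E: "0 < E t" for t
    by (simp add: E_def)
  then have pos: "0 < p + q * E t" for t
    using pq by (intro add_pos_pos) auto
  have dE: "(E has_real_derivative - (p + q) * E t) (at t)"
    unfolding E_def[abs_def] by (auto intro!: derivative_eq_intros)
  have eq: "bass_nonadoption p q = (\<lambda>t. (p + q) * E t / (p + q * E t))"
    using bass_nonadoption_eq[OF pq] by (auto simp: E_def)
  show ?thesis
    unfolding eq using pos[of t]
    by (auto intro!: derivative_eq_intros dE simp: divide_simps power2_eq_square) (simp add: algebra_simps)
qed

lemma bass_nonadoption_power_deriv:
  assumes pq: "0 < p" "0 < q"
  shows "((\<lambda>s. bass_nonadoption p q s ^ n) has_real_derivative
     - (real n * (p + q)) * bass_nonadoption p q s ^ n + real n * q * bass_nonadoption p q s ^ Suc n) (at s)"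
proof (cases n)
  case (Suc m)
  show ?thesis
    unfolding Suc by (rule derivative_eq_intros bass_nonadoption_deriv[OF pq] refl)+ 
      (simp add: power2_eq_square algebra_simps)
qed simp

lemma bass_nonadoption_power_expansion:
  assumes pq: "0 < p" "0 < q" and e: "0 < e"
  shows "\<forall>\<^sub>F h in at_right 0. \<forall>s\<in>{0..t}.
     \<bar>bass_nonadoption p q (s + h) ^ n -
      (bass_nonadoption p q s ^ n + h * (- (real n * (p + q)) * bass_nonadoption p q s ^ n + real n * q * bass_nonadoption p q s ^ Suc n))\<bar> \<le> h * e"
proof (rule uniform_expansion[OF bass_nonadoption_power_deriv[OF pq] _ e])
  have "continuous_on UNIV (bass_nonadoption p q)"
    using bass_nonadoption_deriv[OF pq] by (intro DERIV_continuous_on) (auto intro: has_field_derivative_at_within)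
  then show "continuous_on UNIV (\<lambda>s. - (real n * (p + q)) * bass_nonadoption p q s ^ n + real n * q * bass_nonadoption p q s ^ Suc n)"
    by (intro continuous_intros)
qed

section \<open>Adoption rates and the state algebra\<close>

lemma summable_int_rate:
  assumes "bass_network N" "j \<in> nodes N"
  shows "(\<lambda>k. int_rate N k j * of_bool (b k)) summable_on nodes N"
proof (rule summable_on_comparison_test)
  show "(\<lambda>k. int_rate N k j) summable_on nodes N"
    using assms by (simp add: bass_network_def)
  fix k assume "k \<in> nodes N"
  then have "0 \<le> int_rate N k j"
    using assms by (simp add: bass_network_def)
  then show "int_rate N k j * of_bool (b k) \<le> int_rate N k j" "0 \<le> int_rate N k j * of_bool (b k)"
    by (cases "b k"; simp)+
qed

text \<open>
  Writing the rate as the maximal rate minus the influence of the nonadopters turns products with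
  the event that \<open>S\<close> has not adopted into events of the same kind for \<open>S \<union> {k}\<close>. Keeping only
  finitely many \<open>k\<close> costs an inequality and avoids integrating an infinite sum.
\<close>

lemma adoption_rate_le:
  assumes N: "bass_network N" "j \<in> nodes N" and F: "finite F" "F \<subseteq> nodes N"
  shows "adoption_rate N X j t \<omega> \<le>
     ext_rate N j + total_int_rate N j - (\<Sum>k\<in>F. int_rate N k j * of_bool (\<not> X k t \<omega>))"
proof -
  have nn: "0 \<le> int_rate N k j" if "k \<in> nodes N" for k
    using N that by (simp add: bass_network_def)
  have "(\<Sum>k\<in>F. int_rate N k j * of_bool (\<not> X k t \<omega>))
      \<le> (\<Sum>\<^sub>\<infinity>k\<in>nodes N. int_rate N k j * of_bool (\<not> X k t \<omega>))"
    using F nn by (intro finite_sum_le_infsum summable_int_rate N) auto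
  moreover have "(\<Sum>\<^sub>\<infinity>k\<in>nodes N. int_rate N k j * of_bool (X k t \<omega>))
      + (\<Sum>\<^sub>\<infinity>k\<in>nodes N. int_rate N k j * of_bool (\<not> X k t \<omega>))
      = (\<Sum>\<^sub>\<infinity>k\<in>nodes N. int_rate N k j * of_bool (X k t \<omega>) + int_rate N k j * of_bool (\<not> X k t \<omega>))"
    by (intro infsum_add[symmetric] summable_int_rate N)
  moreover have "\<dots> = total_int_rate N j"
    unfolding total_int_rate_def by (intro infsum_cong) auto
  ultimately show ?thesis
    by (simp add: adoption_rate_def)
qed

lemma adoption_rate_finite:
  assumes "finite (nodes N)"
  shows "adoption_rate N X j t \<omega> =
     ext_rate N j + total_int_rate N j - (\<Sum>k\<in>nodes N. int_rate N k j * of_bool (\<not> X k t \<omega>))"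
proof -
  have "(\<Sum>k\<in>nodes N. int_rate N k j * of_bool (X k t \<omega>)) + (\<Sum>k\<in>nodes N. int_rate N k j * of_bool (\<not> X k t \<omega>))
      = (\<Sum>k\<in>nodes N. int_rate N k j)"
    unfolding sum.distrib[symmetric] by (intro sum.cong) auto
  then show ?thesis
    using assms by (simp add: adoption_rate_def total_int_rate_def)
qed

text \<open>
  The finite sum of \<open>adoption_rate_le\<close> can carry all but an arbitrarily small part of the
  influence.
\<close>

lemma exists_finite_int_rate:
  assumes N: "bass_network N" "j \<in> nodes N" and e: "0 < e"
  obtains F where "finite F" "F \<subseteq> nodes N" "total_int_rate N j - e \<le> (\<Sum>k\<in>F. int_rate N k j)"
proof -
  have "((\<lambda>k. int_rate N k j) has_sum total_int_rate N j) (nodes N)"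
    unfolding total_int_rate_def using N by (intro has_sum_infsum) (simp add: bass_network_def)
  then have "(sum (\<lambda>k. int_rate N k j) \<longlongrightarrow> total_int_rate N j) (finite_subsets_at_top (nodes N))"
    by (simp add: has_sum_def)
  from order_tendstoD(1)[OF this, of "total_int_rate N j - e"] e
  have "\<forall>\<^sub>F F in finite_subsets_at_top (nodes N). total_int_rate N j - e < (\<Sum>k\<in>F. int_rate N k j)"
    by simp
  then obtain F where "finite F" "F \<subseteq> nodes N" "total_int_rate N j - e < (\<Sum>k\<in>F. int_rate N k j)"
    unfolding eventually_finite_subsets_at_top by blast
  then show thesis
    using that[of F] by simp
qed

lemma sets_state_algebra:
  "sets (state_algebra N P X t) = sigma_sets (space P) {{\<omega> \<in> space P. X j t \<omega>} | j. j \<in> nodes N}"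
  and space_state_algebra: "space (state_algebra N P X t) = space P"
  unfolding state_algebra_def by (intro sets_measure_of space_measure_of; blast)+

lemma sets_history_algebra:
  "sets (history_algebra N P X t) =
     sigma_sets (space P) {{\<omega> \<in> space P. X j s \<omega>} | j s. j \<in> nodes N \<and> 0 \<le> s \<and> s \<le> t}"
  and space_history_algebra: "space (history_algebra N P X t) = space P"
  unfolding history_algebra_def by (intro sets_measure_of space_measure_of; blast)+

lemma pred_state_algebra:
  "j \<in> nodes N \<Longrightarrow> Measurable.pred (state_algebra N P X t) (X j t)"
  unfolding pred_def space_state_algebra sets_state_algebra by (rule sigma_sets.Basic) auto

lemma state_le_history:
  assumes "0 \<le> t" shows "sets (state_algebra N P X t) \<subseteq> sets (history_algebra N P X t)"
  unfolding sets_state_algebra sets_history_algebra using assms by (intro sigma_sets_mono') auto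

section \<open>The hierarchy of nonadoption probabilities\<close>

text \<open>
  A Bonferroni inequality, with a common bound for the intersections of pairs. It turns the
  absence of joint adoptions into a lower bound for the probability of some adoption.
\<close>

lemma (in prob_space) prob_UN_ge:
  fixes d :: real
  assumes I: "finite I" and E: "\<And>i. i \<in> I \<Longrightarrow> E i \<in> events" and d: "0 \<le> d"
    and pair: "\<And>i j. i \<in> I \<Longrightarrow> j \<in> I \<Longrightarrow> i \<noteq> j \<Longrightarrow> prob (E i \<inter> E j) \<le> d"
  shows "(\<Sum>i\<in>I. prob (E i)) - (card I)\<^sup>2 * d \<le> prob (\<Union>i\<in>I. E i)"
  using I E pair
proof (induction I rule: finite_induct)
  case (insert a I)
  let ?U = "\<Union>i\<in>I. E i"
  have U: "?U \<in> events" "E a \<in> events"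
    using insert by auto
  have "prob (E a \<inter> ?U) = prob (\<Union>i\<in>I. E a \<inter> E i)"
    by (rule arg_cong[where f = prob]) auto
  also have "\<dots> \<le> (\<Sum>i\<in>I. prob (E a \<inter> E i))"
    using insert by (intro finite_measure_subadditive_finite) auto
  also have "\<dots> \<le> (\<Sum>i\<in>I. d)"
    using insert by (intro sum_mono) auto
  finally have int: "prob (E a \<inter> ?U) \<le> card I * d"
    by simp
  have "prob (E a \<union> ?U) = prob (E a) + prob (?U - E a)"
    using U by (subst finite_measure_Union[symmetric]) (auto intro!: arg_cong[where f = prob])
  moreover have "prob (?U - E a) = prob ?U - prob (E a \<inter> ?U)"
    using U by (subst finite_measure_Diff') (auto simp: Int_commute)
  moreover have "(\<Sum>i\<in>I. prob (E i)) - (card I)\<^sup>2 * d \<le> prob ?U"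
    using insert by auto
  moreover have "(card (insert a I))\<^sup>2 * d = (card I)\<^sup>2 * d + (2 * card I + 1) * d"
    using insert.hyps by (simp add: power2_eq_square algebra_simps)
  moreover have "0 \<le> (card I + 1) * d"
    using d by simp
  ultimately show ?case
    using insert.hyps int by (simp add: algebra_simps)
qed simp

lemma eps_eventually:
  fixes \<epsilon> :: "real \<Rightarrow> real"
  assumes "(\<epsilon> \<longlongrightarrow> 0) (at_right 0)" "0 < e"
  shows "\<forall>\<^sub>F h in at_right 0. \<epsilon> h < e \<and> 0 < h"
  using order_tendstoD(2)[OF assms] eventually_at_right_less by eventually_elim auto

context bass_process begin

definition none_adopted :: "nat set \<Rightarrow> real \<Rightarrow> 'w set" where
  "none_adopted S t = {\<omega> \<in> space P. \<forall>j\<in>S. \<not> X j t \<omega>}"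

definition nonadoption :: "nat set \<Rightarrow> real \<Rightarrow> real" where
  "nonadoption S t = prob (none_adopted S t)"

lemma event_X: "j \<in> nodes N \<Longrightarrow> 0 \<le> t \<Longrightarrow> {\<omega> \<in> space P. X j t \<omega>} \<in> events"
  using random_state by (simp add: pred_def)

lemma subalgebra_state:
  assumes "0 \<le> t" shows "subalgebra P (state_algebra N P X t)"
  unfolding subalgebra_def space_state_algebra sets_state_algebra
  using assms event_X by (auto intro!: sets.sigma_sets_subset)

lemma none_adopted_state:
  assumes "finite S" "S \<subseteq> nodes N"
  shows "none_adopted S t \<in> sets (state_algebra N P X t)"
proof -
  have "Measurable.pred (state_algebra N P X t) (\<lambda>\<omega>. \<forall>j\<in>S. \<not> X j t \<omega>)"
    using assms by (intro pred_intros_finite pred_intros_logic pred_state_algebra) auto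
  then show ?thesis
    by (simp add: pred_def space_state_algebra none_adopted_def)
qed

lemma none_adopted_event:
  assumes "finite S" "S \<subseteq> nodes N" "0 \<le> t"
  shows "none_adopted S t \<in> events"
  using none_adopted_state[OF assms(1,2)] subalgebra_state[OF assms(3)] by (auto simp: subalgebra_def)

text \<open>
  The defining property of conditional expectation, in the form in which the rate axioms are used.
\<close>

lemma prob_Int_cond:
  assumes t: "0 \<le> t" and A: "A \<in> sets (state_algebra N P X t)" and E: "E \<in> events"
  shows "prob (A \<inter> E) = (\<integral>\<omega>. indicator A \<omega> * cond_prob_given P (state_algebra N P X t) E \<omega> \<partial>P)"
    and "integrable P (\<lambda>\<omega>. indicator A \<omega> * cond_prob_given P (state_algebra N P X t) E \<omega>)"
proof -
  interpret F: finite_measure_subalgebra P "state_algebra N P X t"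
    by unfold_locales (rule subalgebra_state[OF t])
  have A': "A \<in> events"
    using A subalgebra_state[OF t] by (auto simp: subalgebra_def)
  have int: "integrable P (indicator E :: _ \<Rightarrow> real)"
    using E by (intro integrable_real_indicator) (auto simp: emeasure_eq_measure)
  show "integrable P (\<lambda>\<omega>. indicator A \<omega> * cond_prob_given P (state_algebra N P X t) E \<omega>)"
    using integrable_mult_indicator[OF A' F.real_cond_exp_int(1)[OF int]] by simp
  have "prob (A \<inter> E) = (\<integral>\<omega>. indicator (A \<inter> E) \<omega> \<partial>P)"
    using A' E by (simp add: Int_absorb2 sets.sets_into_space)
  also have "\<dots> = (\<integral>\<omega>\<in>A. indicator E \<omega> \<partial>P)"
    unfolding set_lebesgue_integral_def
    by (intro Bochner_Integration.integral_cong) (auto simp: indicator_def)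
  also have "\<dots> = (\<integral>\<omega>\<in>A. cond_prob_given P (state_algebra N P X t) E \<omega> \<partial>P)"
    by (rule F.real_cond_exp_intA[OF int A])
  finally show "prob (A \<inter> E) = (\<integral>\<omega>. indicator A \<omega> * cond_prob_given P (state_algebra N P X t) E \<omega> \<partial>P)"
    by (simp add: set_lebesgue_integral_def)
qed

text \<open>
  The expected rate at which node \<open>j\<close> of the nonadopting set \<open>S\<close> adopts, when exactly the
  nodes outside \<open>F\<close> are counted as adopters regardless of their state.
\<close>

definition rate_bound :: "nat set \<Rightarrow> nat set \<Rightarrow> nat \<Rightarrow> real \<Rightarrow> real" where
  "rate_bound S F j t =
     (ext_rate N j + total_int_rate N j) * nonadoption S t - (\<Sum>k\<in>F. int_rate N k j * nonadoption (insert k S) t)"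

lemma integral_rate_bound:
  fixes j :: nat and h c :: real
  assumes S: "finite S" "S \<subseteq> nodes N" and F: "finite F" "F \<subseteq> nodes N" and t: "0 \<le> t"
  defines "g \<equiv> \<lambda>\<omega>. indicator (none_adopted S t) \<omega> *
     ((ext_rate N j + total_int_rate N j - (\<Sum>k\<in>F. int_rate N k j * of_bool (\<not> X k t \<omega>))) * h + c)"
  shows "integrable P g" "(\<integral>\<omega>. g \<omega> \<partial>P) = h * rate_bound S F j t + c * nonadoption S t"
proof -
  let ?r = "ext_rate N j + total_int_rate N j"
  let ?g = "\<lambda>\<omega>. (?r * h + c) * indicator (none_adopted S t) \<omega> - (\<Sum>k\<in>F. (h * int_rate N k j) * indicator (none_adopted (insert k S) t) \<omega>)"
  have eq: "g \<omega> = ?g \<omega>" if "\<omega> \<in> space P" for \<omega>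
  proof -
    have "indicator (none_adopted (insert k S) t) \<omega> = indicator (none_adopted S t) \<omega> * (of_bool (\<not> X k t \<omega>) :: real)" for k
      using that by (auto simp: none_adopted_def indicator_def)
    then show ?thesis
      by (simp add: g_def sum_distrib_left sum_distrib_right algebra_simps)
  qed
  have ev: "none_adopted S t \<in> events" "\<And>k. k \<in> F \<Longrightarrow> none_adopted (insert k S) t \<in> events"
    using S F t by (auto intro!: none_adopted_event)
  have int: "integrable P (indicator (none_adopted S t) :: _ \<Rightarrow> real)" "\<And>k. k \<in> F \<Longrightarrow> integrable P (indicator (none_adopted (insert k S) t) :: _ \<Rightarrow> real)"
    using ev by (auto intro!: integrable_real_indicator simp: emeasure_eq_measure)
  show "integrable P g"
    by (subst Bochner_Integration.integrable_cong[OF refl eq], assumption)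
      (intro Bochner_Integration.integrable_diff Bochner_Integration.integrable_sum integrable_mult_right int)
  have E: "none_adopted S' t \<inter> space P = none_adopted S' t" for S'
    by (auto simp: none_adopted_def)
  have "(\<integral>\<omega>. g \<omega> \<partial>P) = (\<integral>\<omega>. ?g \<omega> \<partial>P)"
    by (intro Bochner_Integration.integral_cong refl eq)
  also have "\<dots> = (\<integral>\<omega>. (?r * h + c) * indicator (none_adopted S t) \<omega> \<partial>P)
      - (\<Sum>k\<in>F. \<integral>\<omega>. (h * int_rate N k j) * indicator (none_adopted (insert k S) t) \<omega> \<partial>P)"
    by (subst Bochner_Integration.integral_diff, (intro Bochner_Integration.integrable_sum integrable_mult_right int, assumption?)+)
      (subst Bochner_Integration.integral_sum, (intro integrable_mult_right int, assumption), rule refl)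
  also have "\<dots> = (?r * h + c) * nonadoption S t - (\<Sum>k\<in>F. (h * int_rate N k j) * nonadoption (insert k S) t)"
    by (simp add: E nonadoption_def)
  also have "\<dots> = h * rate_bound S F j t + c * nonadoption S t"
    by (simp add: rate_bound_def sum_distrib_left algebra_simps)
  finally show "(\<integral>\<omega>. g \<omega> \<partial>P) = h * rate_bound S F j t + c * nonadoption S t" .
qed

lemma nonadoption_nonneg: "0 \<le> nonadoption S t" and nonadoption_le_1: "nonadoption S t \<le> 1"
  by (simp_all add: nonadoption_def)

lemma adoption_le:
  assumes S: "finite S" "S \<subseteq> nodes N" and j: "j \<in> S" and F: "finite F" "F \<subseteq> nodes N" and e: "0 < e"
  shows "\<forall>\<^sub>F h in at_right 0. \<forall>t\<ge>0.
     prob (none_adopted S t \<inter> {\<omega> \<in> space P. X j (t + h) \<omega>}) \<le> h * (rate_bound S F j t + e)"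
proof -
  have jN: "j \<in> nodes N" using j S by auto
  obtain \<epsilon> where \<epsilon>: "(\<epsilon> \<longlongrightarrow> 0) (at_right 0)"
    and rate: "\<And>t h. t \<ge> 0 \<Longrightarrow> h > 0 \<Longrightarrow> AE \<omega> in P.
              let c = cond_prob_given P (state_algebra N P X t) {\<omega> \<in> space P. X j (t + h) \<omega>} \<omega>
              in if X j t \<omega> then c = 1
                 else \<bar>c - adoption_rate N X j t \<omega> * h\<bar> \<le> \<epsilon> h * h"
    using adopts_at_rate[OF jN] by blast
  show ?thesis
    using eps_eventually[OF \<epsilon> e]
  proof (eventually_elim, intro allI impI)
    fix h t :: real assume h: "\<epsilon> h < e \<and> 0 < h" and t: "0 \<le> t"
    let ?E = "{\<omega> \<in> space P. X j (t + h) \<omega>}"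
    let ?g = "\<lambda>\<omega>. indicator (none_adopted S t) \<omega> *
     ((ext_rate N j + total_int_rate N j - (\<Sum>k\<in>F. int_rate N k j * of_bool (\<not> X k t \<omega>))) * h + e * h)"
    have E: "?E \<in> events" using jN t h by (intro event_X) auto
    have "prob (none_adopted S t \<inter> ?E) \<le> (\<integral>\<omega>. ?g \<omega> \<partial>P)"
      unfolding prob_Int_cond(1)[OF t none_adopted_state[OF S] E]
    proof (intro integral_mono_AE prob_Int_cond(2) t none_adopted_state S E integral_rate_bound(1) F)
      show "AE \<omega> in P. indicator (none_adopted S t) \<omega> * cond_prob_given P (state_algebra N P X t) ?E \<omega> \<le> ?g \<omega>"
        using rate[OF t conjunct2[OF h]]
      proof eventually_elim
        fix \<omega> assume c: "let c = cond_prob_given P (state_algebra N P X t) ?E \<omega>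
              in if X j t \<omega> then c = 1 else \<bar>c - adoption_rate N X j t \<omega> * h\<bar> \<le> \<epsilon> h * h"
        show "indicator (none_adopted S t) \<omega> * cond_prob_given P (state_algebra N P X t) ?E \<omega> \<le> ?g \<omega>"
        proof (cases "\<omega> \<in> none_adopted S t")
          case True
          then have "\<not> X j t \<omega>" using j by (auto simp: none_adopted_def)
          then have "cond_prob_given P (state_algebra N P X t) ?E \<omega> \<le> adoption_rate N X j t \<omega> * h + \<epsilon> h * h"
            using c by (simp add: Let_def abs_le_iff)
          also have "\<dots> \<le> (ext_rate N j + total_int_rate N j - (\<Sum>k\<in>F. int_rate N k j * of_bool (\<not> X k t \<omega>))) * h + e * h"
            using h by (intro add_mono mult_right_mono adoption_rate_le network jN F) auto
          finally show ?thesis using True by simp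
        qed simp
      qed
    qed
    also have "\<dots> = h * rate_bound S F j t + e * h * nonadoption S t"
      by (rule integral_rate_bound(2)[OF S F t])
    also have "\<dots> \<le> h * (rate_bound S F j t + e)"
      using h e nonadoption_le_1[of S t] by (simp add: algebra_simps mult_le_cancel_left2)
    finally show "prob (none_adopted S t \<inter> ?E) \<le> h * (rate_bound S F j t + e)" .
  qed
qed

text \<open>
  On a finite network all influences are retained, and the rate is exact up to the error of the
  expansion.
\<close>

lemma adoption_ge:
  assumes fin: "finite (nodes N)" and S: "S \<subseteq> nodes N" and j: "j \<in> S" and e: "0 < e"
  shows "\<forall>\<^sub>F h in at_right 0. \<forall>t\<ge>0.
     h * (rate_bound S (nodes N) j t - e) \<le> prob (none_adopted S t \<inter> {\<omega> \<in> space P. X j (t + h) \<omega>})"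
proof -
  have jN: "j \<in> nodes N" using j S by auto
  have finS: "finite S" using fin S finite_subset by auto
  obtain \<epsilon> where \<epsilon>: "(\<epsilon> \<longlongrightarrow> 0) (at_right 0)"
    and rate: "\<And>t h. t \<ge> 0 \<Longrightarrow> h > 0 \<Longrightarrow> AE \<omega> in P.
              let c = cond_prob_given P (state_algebra N P X t) {\<omega> \<in> space P. X j (t + h) \<omega>} \<omega>
              in if X j t \<omega> then c = 1
                 else \<bar>c - adoption_rate N X j t \<omega> * h\<bar> \<le> \<epsilon> h * h"
    using adopts_at_rate[OF jN] by blast
  show ?thesis
    using eps_eventually[OF \<epsilon> e]
  proof (eventually_elim, intro allI impI)
    fix h t :: real assume h: "\<epsilon> h < e \<and> 0 < h" and t: "0 \<le> t"
    let ?E = "{\<omega> \<in> space P. X j (t + h) \<omega>}"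
    let ?g = "\<lambda>\<omega>. indicator (none_adopted S t) \<omega> *
     ((ext_rate N j + total_int_rate N j - (\<Sum>k\<in>nodes N. int_rate N k j * of_bool (\<not> X k t \<omega>))) * h + (- e * h))"
    have E: "?E \<in> events" using jN t h by (intro event_X) auto
    have "h * (rate_bound S (nodes N) j t - e) \<le> h * rate_bound S (nodes N) j t + - e * h * nonadoption S t"
      using h e nonadoption_le_1[of S t] by (simp add: algebra_simps mult_le_cancel_left2)
    also have "\<dots> = (\<integral>\<omega>. ?g \<omega> \<partial>P)"
      by (rule integral_rate_bound(2)[OF finS S fin order_refl t, symmetric])
    also have "\<dots> \<le> prob (none_adopted S t \<inter> ?E)"
      unfolding prob_Int_cond(1)[OF t none_adopted_state[OF finS S] E]
    proof (intro integral_mono_AE prob_Int_cond(2) t none_adopted_state finS S E integral_rate_bound(1) fin order_refl)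
      show "AE \<omega> in P. ?g \<omega> \<le> indicator (none_adopted S t) \<omega> * cond_prob_given P (state_algebra N P X t) ?E \<omega>"
        using rate[OF t conjunct2[OF h]]
      proof eventually_elim
        fix \<omega> assume c: "let c = cond_prob_given P (state_algebra N P X t) ?E \<omega>
              in if X j t \<omega> then c = 1 else \<bar>c - adoption_rate N X j t \<omega> * h\<bar> \<le> \<epsilon> h * h"
        show "?g \<omega> \<le> indicator (none_adopted S t) \<omega> * cond_prob_given P (state_algebra N P X t) ?E \<omega>"
        proof (cases "\<omega> \<in> none_adopted S t")
          case True
          then have "\<not> X j t \<omega>" using j by (auto simp: none_adopted_def)
          then have "adoption_rate N X j t \<omega> * h - \<epsilon> h * h \<le> cond_prob_given P (state_algebra N P X t) ?E \<omega>"
            using c by (simp add: Let_def abs_le_iff)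
          moreover have "\<epsilon> h * h \<le> e * h"
            using h by (intro mult_right_mono) auto
          ultimately show ?thesis using True unfolding adoption_rate_finite[OF fin] by simp
        qed simp
      qed
    qed
    finally show "h * (rate_bound S (nodes N) j t - e) \<le> prob (none_adopted S t \<inter> ?E)" .
  qed
qed

lemma joint_adoption_le:
  assumes S: "finite S" "S \<subseteq> nodes N" and ij: "i \<in> S" "j \<in> S" "i \<noteq> j" and e: "0 < e"
  shows "\<forall>\<^sub>F h in at_right 0. \<forall>t\<ge>0.
     prob (none_adopted S t \<inter> {\<omega> \<in> space P. X i (t + h) \<omega> \<and> X j (t + h) \<omega>}) \<le> h * e"
proof -
  have ijN: "i \<in> nodes N" "j \<in> nodes N" using ij S by auto
  obtain \<epsilon> where \<epsilon>: "(\<epsilon> \<longlongrightarrow> 0) (at_right 0)"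
    and joint: "\<And>t h. t \<ge> 0 \<Longrightarrow> h > 0 \<Longrightarrow> AE \<omega> in P. \<not> X i t \<omega> \<and> \<not> X j t \<omega> \<longrightarrow>
              cond_prob_given P (state_algebra N P X t)
                {\<omega> \<in> space P. X i (t + h) \<omega> \<and> X j (t + h) \<omega>} \<omega> \<le> \<epsilon> h * h"
    using no_joint_adoption[OF ijN ij(3)] by blast
  show ?thesis
    using eps_eventually[OF \<epsilon> e]
  proof (eventually_elim, intro allI impI)
    fix h t :: real assume h: "\<epsilon> h < e \<and> 0 < h" and t: "0 \<le> t"
    let ?E = "{\<omega> \<in> space P. X i (t + h) \<omega> \<and> X j (t + h) \<omega>}"
    have "?E = {\<omega> \<in> space P. X i (t + h) \<omega>} \<inter> {\<omega> \<in> space P. X j (t + h) \<omega>}"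
      by auto
    then have E: "?E \<in> events"
      using ijN t h by (auto intro!: event_X)
    have ev: "none_adopted S t \<in> events"
      by (rule none_adopted_event[OF S t])
    have "prob (none_adopted S t \<inter> ?E) \<le> (\<integral>\<omega>. indicator (none_adopted S t) \<omega> * (e * h) \<partial>P)"
      unfolding prob_Int_cond(1)[OF t none_adopted_state[OF S] E]
    proof (intro integral_mono_AE prob_Int_cond(2) t none_adopted_state S E)
      show "integrable P (\<lambda>\<omega>. indicator (none_adopted S t) \<omega> * (e * h))"
        using ev by (intro integrable_mult_left integrable_real_indicator) (auto simp: emeasure_eq_measure)
      show "AE \<omega> in P. indicator (none_adopted S t) \<omega> * cond_prob_given P (state_algebra N P X t) ?E \<omega> \<le> indicator (none_adopted S t) \<omega> * (e * h)"
        using joint[OF t conjunct2[OF h]]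
      proof eventually_elim
        fix \<omega> assume c: "\<not> X i t \<omega> \<and> \<not> X j t \<omega> \<longrightarrow> cond_prob_given P (state_algebra N P X t) ?E \<omega> \<le> \<epsilon> h * h"
        have "\<epsilon> h * h \<le> e * h"
          using h by (intro mult_right_mono) auto
        then show "indicator (none_adopted S t) \<omega> * cond_prob_given P (state_algebra N P X t) ?E \<omega> \<le> indicator (none_adopted S t) \<omega> * (e * h)"
          using c ij by (cases "\<omega> \<in> none_adopted S t") (auto simp: none_adopted_def)
      qed
    qed
    also have "\<dots> = nonadoption S t * (e * h)"
      using ev by (simp add: nonadoption_def Int_absorb2 sets.sets_into_space)
    also have "\<dots> \<le> 1 * (e * h)"
      using h e nonadoption_le_1[of S t] by (intro mult_right_mono) auto
    finally show "prob (none_adopted S t \<inter> ?E) \<le> h * e"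
      by (simp add: mult.commute)
  qed
qed

lemma nonadoption_step:
  assumes S: "finite S" "S \<subseteq> nodes N" and t: "0 \<le> t" "0 \<le> h"
  shows "nonadoption S (t + h) = nonadoption S t - prob (\<Union>j\<in>S. none_adopted S t \<inter> {\<omega> \<in> space P. X j (t + h) \<omega>})"
proof -
  let ?U = "\<Union>j\<in>S. none_adopted S t \<inter> {\<omega> \<in> space P. X j (t + h) \<omega>}"
  have ev: "none_adopted S t \<in> events" "\<And>j. j \<in> S \<Longrightarrow> {\<omega> \<in> space P. X j (t + h) \<omega>} \<in> events"
    using S t by (auto intro!: none_adopted_event event_X)
  have "none_adopted S (t + h) = none_adopted S t - ?U"
    using remains_adopter[of _ _ t "t + h"] S t by (fastforce simp: none_adopted_def)
  moreover have "?U \<in> events"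
    using ev S by auto
  moreover have "?U \<subseteq> none_adopted S t" by auto
  ultimately show ?thesis
    using ev by (simp add: nonadoption_def finite_measure_Diff)
qed

text \<open>
  The hierarchy as an inequality: the union bound suffices in this direction.
\<close>

lemma nonadoption_step_ge:
  assumes S: "finite S" "S \<subseteq> nodes N" and F: "\<And>j. j \<in> S \<Longrightarrow> finite (F j) \<and> F j \<subseteq> nodes N" and e: "0 < e"
  shows "\<forall>\<^sub>F h in at_right 0. \<forall>t\<ge>0. nonadoption S t - h * ((\<Sum>j\<in>S. rate_bound S (F j) j t) + e) \<le> nonadoption S (t + h)"
proof -
  let ?e = "e / (card S + 1)"
  have e': "0 < ?e" using e by simp
  have "\<forall>\<^sub>F h in at_right 0. \<forall>j\<in>S. \<forall>t\<ge>0.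
     prob (none_adopted S t \<inter> {\<omega> \<in> space P. X j (t + h) \<omega>}) \<le> h * (rate_bound S (F j) j t + ?e)"
    using S F e' by (intro eventually_ball_finite ballI adoption_le) auto
  then show ?thesis
    using eventually_at_right_less
  proof (eventually_elim, intro allI impI)
    fix h t :: real
    assume le: "\<forall>j\<in>S. \<forall>t\<ge>0. prob (none_adopted S t \<inter> {\<omega> \<in> space P. X j (t + h) \<omega>}) \<le> h * (rate_bound S (F j) j t + ?e)"
      and h: "0 < h" and t: "0 \<le> t"
    have "prob (\<Union>j\<in>S. none_adopted S t \<inter> {\<omega> \<in> space P. X j (t + h) \<omega>})
        \<le> (\<Sum>j\<in>S. prob (none_adopted S t \<inter> {\<omega> \<in> space P. X j (t + h) \<omega>}))"
      using S h t by (intro finite_measure_subadditive_finite) (auto intro!: none_adopted_event event_X)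
    also have "\<dots> \<le> (\<Sum>j\<in>S. h * (rate_bound S (F j) j t + ?e))"
      using le t by (intro sum_mono) auto
    also have "\<dots> = h * ((\<Sum>j\<in>S. rate_bound S (F j) j t) + card S * ?e)"
      by (simp add: sum_distrib_left[symmetric] sum.distrib)
    also have "\<dots> \<le> h * ((\<Sum>j\<in>S. rate_bound S (F j) j t) + e)"
      using h e by (intro mult_left_mono add_left_mono) (auto simp: field_simps)
    finally show "nonadoption S t - h * ((\<Sum>j\<in>S. rate_bound S (F j) j t) + e) \<le> nonadoption S (t + h)"
      using nonadoption_step[OF S t, of h] h by simp
  qed
qed

text \<open>
  The opposite inequality, where simultaneous adoptions have to be negligible.
\<close>

lemma nonadoption_step_le:
  assumes fin: "finite (nodes N)" and S: "S \<subseteq> nodes N" and e: "0 < e"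
  shows "\<forall>\<^sub>F h in at_right 0. \<forall>t\<ge>0. nonadoption S (t + h) \<le> nonadoption S t - h * ((\<Sum>j\<in>S. rate_bound S (nodes N) j t) - e)"
proof -
  have finS: "finite S" using fin S finite_subset by auto
  let ?e = "e / (2 * (card S + 1))" and ?d = "e / (2 * ((card S)\<^sup>2 + 1))"
  have e': "0 < ?e" "0 < ?d"
    by (rule divide_pos_pos[OF e], simp only: of_nat_0_less_iff, simp)+
  have "\<forall>\<^sub>F h in at_right 0. \<forall>j\<in>S. \<forall>t\<ge>0.
     h * (rate_bound S (nodes N) j t - ?e) \<le> prob (none_adopted S t \<inter> {\<omega> \<in> space P. X j (t + h) \<omega>})"
    using S e' fin by (intro eventually_ball_finite finS ballI adoption_ge) auto
  moreover have "\<forall>\<^sub>F h in at_right 0. \<forall>i\<in>S. \<forall>j\<in>S - {i}. \<forall>t\<ge>0.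
     prob (none_adopted S t \<inter> {\<omega> \<in> space P. X i (t + h) \<omega> \<and> X j (t + h) \<omega>}) \<le> h * ?d"
    using S e' finS by (intro eventually_ball_finite ballI joint_adoption_le) auto
  ultimately show ?thesis
    using eventually_at_right_less
  proof (eventually_elim, intro allI impI)
    fix h t :: real
    let ?E = "\<lambda>j. none_adopted S t \<inter> {\<omega> \<in> space P. X j (t + h) \<omega>}"
    assume ge: "\<forall>j\<in>S. \<forall>t\<ge>0. h * (rate_bound S (nodes N) j t - ?e) \<le> prob (none_adopted S t \<inter> {\<omega> \<in> space P. X j (t + h) \<omega>})"
      and joint: "\<forall>i\<in>S. \<forall>j\<in>S - {i}. \<forall>t\<ge>0. prob (none_adopted S t \<inter> {\<omega> \<in> space P. X i (t + h) \<omega> \<and> X j (t + h) \<omega>}) \<le> h * ?d"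
      and h: "0 < h" and t: "0 \<le> t"
    have "h * ((\<Sum>j\<in>S. rate_bound S (nodes N) j t) - e)
        \<le> h * ((\<Sum>j\<in>S. rate_bound S (nodes N) j t) - card S * ?e - (card S)\<^sup>2 * ?d)"
    proof (intro mult_left_mono)
      have half: "real m * (e / real (2 * (m + 1))) \<le> e / 2" for m
        using e by (simp add: field_simps)
      have "card S * ?e \<le> e / 2" "(card S)\<^sup>2 * ?d \<le> e / 2"
        by (rule half)+
      then show "(\<Sum>j\<in>S. rate_bound S (nodes N) j t) - e \<le> (\<Sum>j\<in>S. rate_bound S (nodes N) j t) - card S * ?e - (card S)\<^sup>2 * ?d"
        by linarith
    qed (use h in simp)
    also have "\<dots> = (\<Sum>j\<in>S. h * (rate_bound S (nodes N) j t - ?e)) - (card S)\<^sup>2 * (h * ?d)"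
      by (simp add: sum_distrib_left[symmetric] sum_subtractf algebra_simps)
    also have "\<dots> \<le> (\<Sum>j\<in>S. prob (?E j)) - (card S)\<^sup>2 * (h * ?d)"
      using ge t by (intro diff_right_mono sum_mono) auto
    also have "\<dots> \<le> prob (\<Union>j\<in>S. ?E j)"
    proof (rule prob_UN_ge[OF finS])
      show "?E i \<in> events" if "i \<in> S" for i
        using that S finS h t by (auto intro!: none_adopted_event event_X)
      show "0 \<le> h * ?d" by (intro mult_nonneg_nonneg less_imp_le[OF h] less_imp_le[OF e'(2)])
      show "prob (?E i \<inter> ?E j) \<le> h * ?d" if "i \<in> S" "j \<in> S" "i \<noteq> j" for i j
      proof -
        have "?E i \<inter> ?E j = none_adopted S t \<inter> {\<omega> \<in> space P. X i (t + h) \<omega> \<and> X j (t + h) \<omega>}"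
          by auto
        then show ?thesis
          using joint that t by simp
      qed
    qed
    finally show "nonadoption S (t + h) \<le> nonadoption S t - h * ((\<Sum>j\<in>S. rate_bound S (nodes N) j t) - e)"
      using nonadoption_step[OF finS S t, of h] h by simp
  qed
qed

lemma nonadoption_0: "S \<subseteq> nodes N \<Longrightarrow> nonadoption S 0 = 1"
proof -
  assume "S \<subseteq> nodes N"
  then have "none_adopted S 0 = space P"
    using initially_nonadopter by (auto simp: none_adopted_def)
  then show ?thesis by (simp add: nonadoption_def prob_space)
qed

lemma adoption_prob_eq:
  assumes "j \<in> nodes N" "0 \<le> t"
  shows "adoption_prob P X j t = 1 - nonadoption {j} t"
proof -
  have "none_adopted {j} t = space P - {\<omega> \<in> space P. X j t \<omega>}"
    by (auto simp: none_adopted_def)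
  then show ?thesis
    using prob_compl[OF event_X[OF assms]] by (simp add: nonadoption_def adoption_prob_def)
qed

end

section \<open>The Bass formula bounds every adoption probability\<close>

lemma card_insert_power_le:
  fixes y :: real
  assumes "finite S" "0 \<le> y" "y \<le> 1"
  shows "y ^ Suc (card S) \<le> y ^ card (insert k S)"
  using assms by (intro power_decreasing) (auto simp: card_insert_if)

locale uniform_bass_process = bass_process P N X
  for P :: "'w measure" and N X +
  fixes p q :: real
  assumes p: "0 < p" and q: "0 < q"
    and uniform: "j \<in> nodes N \<Longrightarrow> ext_rate N j = p \<and> total_int_rate N j = q"
begin

abbreviation "y \<equiv> bass_nonadoption p q"

text \<open>
  One step of the contraction. Inserting the bound \<open>[S \<union> {k}] \<ge> y ^ (n + 1) - E\<close> into the
  hierarchy closes it: the difference relaxes at rate \<open>n (p + q)\<close> and is driven by at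
  most \<open>n q E\<close>.
\<close>

lemma nonadoption_ge_contract:
  assumes E: "0 \<le> E" "\<And>S t. finite S \<Longrightarrow> S \<noteq> {} \<Longrightarrow> S \<subseteq> nodes N \<Longrightarrow> 0 \<le> t \<Longrightarrow> y t ^ card S - nonadoption S t \<le> E"
    and S: "finite S" "S \<noteq> {}" "S \<subseteq> nodes N" and t: "0 \<le> t"
  shows "y t ^ card S - nonadoption S t \<le> q / (p + q) * E"
proof -
  let ?n = "real (card S)"
  let ?a = "?n * (p + q)" and ?b = "?n * q * E"
  let ?D = "\<lambda>t. y t ^ card S - nonadoption S t"
  have n: "0 < ?n" using S by (simp add: card_gt_0_iff)
  have "?D t \<le> ?b / ?a"
  proof (rule discrete_comparison[OF _ t])
    show "0 < ?a" using n p q by simp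
    show "?D 0 \<le> ?b / ?a"
      using p q E(1) by (simp add: bass_nonadoption_0 nonadoption_0[OF S(3)])
    fix e :: real assume e: "0 < e"
    \<comment> \<open>The truncation of the influences may cost \<open>e / 3\<close> in total, hence \<open>\<eta>\<close> for each node
      of \<open>S\<close>; the two expansions take the other two thirds of \<open>e\<close>.\<close>
    define \<eta> where "\<eta> = e / 3 / ?n"
    have \<eta>: "0 < \<eta>" "?n * \<eta> = e / 3" using e n by (simp_all add: \<eta>_def)
    have "\<exists>F. finite F \<and> F \<subseteq> nodes N \<and> q - \<eta> \<le> (\<Sum>k\<in>F. int_rate N k j)" if "j \<in> S" for j
      using exists_finite_int_rate[OF network _ \<eta>(1), of j] that S(3) uniform[of j] by (metis subsetD)
    then obtain F where F: "\<And>j. j \<in> S \<Longrightarrow> finite (F j) \<and> F j \<subseteq> nodes N \<and> q - \<eta> \<le> (\<Sum>k\<in>F j. int_rate N k j)"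
      by metis
    have rb: "rate_bound S (F j) j s \<le> (p + q) * nonadoption S s - q * (y s ^ Suc (card S) - E) + \<eta>"
      if j: "j \<in> S" and s: "0 \<le> s" for j s
    proof -
      \<comment> \<open>The cut at \<open>0\<close> is needed because the truncated sum of influences is a lower bound for \<open>q\<close>
        only up to \<open>\<eta>\<close>, and multiplying by a negative number would reverse it.\<close>
      let ?v = "max 0 (y s ^ Suc (card S) - E)"
      note yb = bass_nonadoption_bounds[OF p q s]
      have "y s ^ Suc (card S) \<le> 1"
        using yb by (rule power_le_one)
      then have v: "0 \<le> ?v" "?v \<le> 1"
        using E(1) by auto
      have nn: "?v \<le> nonadoption (insert k S) s" if "k \<in> F j" for k
      proof -
        have "y s ^ Suc (card S) - E \<le> y s ^ card (insert k S) - E"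
          using card_insert_power_le[OF S(1) yb] by simp
        also have "\<dots> \<le> nonadoption (insert k S) s"
          using E(2)[of "insert k S" s] S F[OF j] that s by auto
        finally show ?thesis by (simp add: nonadoption_nonneg)
      qed
      have rate_nn: "0 \<le> int_rate N k j" if "k \<in> F j" for k
      proof -
        have "k \<in> nodes N" "j \<in> nodes N"
          using F[OF j] that j S(3) by auto
        then show ?thesis
          using network by (simp add: bass_network_def)
      qed
      have "q * (y s ^ Suc (card S) - E) - \<eta> \<le> q * ?v - \<eta> * ?v"
        using q v \<eta>(1) by (intro diff_mono mult_left_mono) (auto simp: mult_le_cancel_left2)
      also have "\<dots> = (q - \<eta>) * ?v"
        by (simp add: algebra_simps)
      also have "\<dots> \<le> (\<Sum>k\<in>F j. int_rate N k j) * ?v"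
        using F[OF j] v by (intro mult_right_mono) auto
      also have "\<dots> = (\<Sum>k\<in>F j. int_rate N k j * ?v)"
        by (rule sum_distrib_right)
      also have "\<dots> \<le> (\<Sum>k\<in>F j. int_rate N k j * nonadoption (insert k S) s)"
        by (intro sum_mono mult_left_mono nn rate_nn)
      finally show ?thesis
        using uniform[of j] S(3) j by (auto simp: rate_bound_def)
    qed
    have "\<forall>\<^sub>F h in at_right 0. \<forall>s\<ge>0. nonadoption S s - h * ((\<Sum>j\<in>S. rate_bound S (F j) j s) + e / 3) \<le> nonadoption S (s + h)"
      using F S e by (intro nonadoption_step_ge) auto
    moreover have "\<forall>\<^sub>F h in at_right 0. \<forall>s\<in>{0..t}.
       \<bar>y (s + h) ^ card S - (y s ^ card S + h * (- ?a * y s ^ card S + ?n * q * y s ^ Suc (card S)))\<bar> \<le> h * (e / 3)"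
      using e by (intro bass_nonadoption_power_expansion p q) simp
    ultimately show "\<forall>\<^sub>F h in at_right 0. \<forall>s\<in>{0..t}. ?D (s + h) \<le> ?D s - h * (?a * ?D s - ?b - e)"
      using eventually_at_right_less
    proof (eventually_elim, intro ballI)
      fix h s :: real
      assume nonadoption: "\<forall>s\<ge>0. nonadoption S s - h * ((\<Sum>j\<in>S. rate_bound S (F j) j s) + e / 3) \<le> nonadoption S (s + h)"
        and yy: "\<forall>s\<in>{0..t}. \<bar>y (s + h) ^ card S - (y s ^ card S + h * (- ?a * y s ^ card S + ?n * q * y s ^ Suc (card S)))\<bar> \<le> h * (e / 3)"
        and h: "0 < h" and s: "s \<in> {0..t}"
      have "(\<Sum>j\<in>S. rate_bound S (F j) j s) \<le> (\<Sum>j\<in>S. (p + q) * nonadoption S s - q * (y s ^ Suc (card S) - E) + \<eta>)"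
        using rb s by (intro sum_mono) auto
      also have "\<dots> = ?a * nonadoption S s - ?n * q * y s ^ Suc (card S) + ?b + e / 3"
        using \<eta>(2) by (simp add: algebra_simps)
      finally have "h * ((\<Sum>j\<in>S. rate_bound S (F j) j s) + e / 3)
          \<le> h * (?a * nonadoption S s - ?n * q * y s ^ Suc (card S) + ?b + e / 3 + e / 3)"
        using h by (intro mult_left_mono) auto
      then have "nonadoption S s - h * (?a * nonadoption S s - ?n * q * y s ^ Suc (card S) + ?b + e / 3 + e / 3) \<le> nonadoption S (s + h)"
        using nonadoption s by force
      moreover have "y (s + h) ^ card S \<le> y s ^ card S + h * (- ?a * y s ^ card S + ?n * q * y s ^ Suc (card S)) + h * (e / 3)"
        using bspec[OF yy s] unfolding abs_le_iff by linarith
      ultimately have "?D (s + h) \<le> y s ^ card S + h * (- ?a * y s ^ card S + ?n * q * y s ^ Suc (card S)) + h * (e / 3)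
          - (nonadoption S s - h * (?a * nonadoption S s - ?n * q * y s ^ Suc (card S) + ?b + e / 3 + e / 3))"
        by linarith
      also have "\<dots> = ?D s - h * (?a * ?D s - ?b - e)"
        by (simp add: algebra_simps)
      finally show "?D (s + h) \<le> ?D s - h * (?a * ?D s - ?b - e)" .
    qed
  qed
  also have "?b / ?a = q / (p + q) * E"
    using n by simp
  finally show ?thesis .
qed

theorem nonadoption_ge_power:
  assumes S: "finite S" "S \<noteq> {}" "S \<subseteq> nodes N" and t: "0 \<le> t"
  shows "y t ^ card S \<le> nonadoption S t"
proof -
  let ?r = "q / (p + q)"
  have r: "0 \<le> ?r" "?r < 1" using p q by auto
  have "y t ^ card S - nonadoption S t \<le> ?r ^ m"
    if "finite S" "S \<noteq> {}" "S \<subseteq> nodes N" "0 \<le> t" for m S t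
    using that
  proof (induction m arbitrary: S t)
    case 0
    have "y t ^ card S \<le> 1"
      using bass_nonadoption_bounds[OF p q 0(4)] by (rule power_le_one)
    then show ?case using nonadoption_nonneg[of S t] by simp
  next
    case (Suc m)
    then show ?case
      using nonadoption_ge_contract[of "?r ^ m" S t] r by simp
  qed
  then have "\<forall>m. y t ^ card S - nonadoption S t \<le> ?r ^ m"
    using S t by blast
  moreover have "(\<lambda>m. ?r ^ m) \<longlonglongrightarrow> 0"
    by (rule LIMSEQ_realpow_zero[OF r])
  ultimately have "y t ^ card S - nonadoption S t \<le> 0"
    by (intro LIMSEQ_le_const) auto
  then show ?thesis by simp
qed

theorem adoption_prob_le_f_Bass:
  assumes j: "j \<in> nodes N" and t: "0 \<le> t"
  shows "adoption_prob P X j t \<le> f_Bass t p q"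
  using nonadoption_ge_power[of "{j}" t] j t adoption_prob_eq[OF j t] by (simp add: bass_nonadoption_def)

section \<open>Networks of small individual influences\<close>

text \<open>
  The terms of the hierarchy with \<open>k \<in> S\<close> are the only place where a network falls short of the
  Bass formula. Their factors \<open>[S \<union> {k}] = [S]\<close> are bounded by \<open>1\<close>, which is harmless as soon as
  the individual influences are small.
\<close>

lemma nonadoption_le_contract:
  fixes \<kappa> :: real
  assumes fin: "finite (nodes N)"
    and \<kappa>: "0 \<le> \<kappa>" "\<And>k j. k \<in> nodes N \<Longrightarrow> j \<in> nodes N \<Longrightarrow> int_rate N k j \<le> \<kappa>"
    and S: "S \<noteq> {}" "S \<subseteq> nodes N"
    and E: "0 \<le> E" "\<And>k t. k \<in> nodes N - S \<Longrightarrow> 0 \<le> t \<Longrightarrow> nonadoption (insert k S) t - y t ^ Suc (card S) \<le> E"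
    and t: "0 \<le> t"
  shows "nonadoption S t - y t ^ card S \<le> (q * E + card S * \<kappa>) / (p + q)"
proof -
  have finS: "finite S" using fin S(2) finite_subset by blast
  let ?n = "real (card S)"
  let ?a = "?n * (p + q)" and ?b = "?n * (q * E + ?n * \<kappa>)"
  let ?D = "\<lambda>t. nonadoption S t - y t ^ card S"
  have n: "0 < ?n" using S finS by (simp add: card_gt_0_iff)
  have "?D t \<le> ?b / ?a"
  proof (rule discrete_comparison[OF _ t])
    show "0 < ?a" using n p q by simp
    show "?D 0 \<le> ?b / ?a"
      using p q E(1) \<kappa>(1) by (simp add: bass_nonadoption_0 nonadoption_0[OF S(2)])
    fix e :: real assume e: "0 < e"
    have rb: "(p + q) * nonadoption S s - q * y s ^ Suc (card S) - q * E - ?n * \<kappa> \<le> rate_bound S (nodes N) j s"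
      if j: "j \<in> S" and s: "0 \<le> s" for j s
    proof -
      have jN: "j \<in> nodes N" using j S by auto
      have nn: "0 \<le> int_rate N k j" if "k \<in> nodes N" for k
        using network that jN by (simp add: bass_network_def)
      have ys: "0 \<le> y s ^ Suc (card S)"
        using bass_nonadoption_bounds[OF p q s] by (intro zero_le_power)
      have "(\<Sum>k\<in>nodes N. int_rate N k j * nonadoption (insert k S) s)
          = (\<Sum>k\<in>nodes N - S. int_rate N k j * nonadoption (insert k S) s) + (\<Sum>k\<in>S. int_rate N k j * nonadoption (insert k S) s)"
        using fin S by (intro sum.subset_diff) auto
      also have "(\<Sum>k\<in>nodes N - S. int_rate N k j * nonadoption (insert k S) s) \<le> (\<Sum>k\<in>nodes N - S. int_rate N k j * (y s ^ Suc (card S) + E))"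
        using nn E(2) s by (intro sum_mono mult_left_mono) (auto simp: algebra_simps)
      also have "\<dots> \<le> (\<Sum>k\<in>nodes N. int_rate N k j * (y s ^ Suc (card S) + E))"
        using fin nn ys E(1) by (intro sum_mono2) auto
      also have "\<dots> = q * (y s ^ Suc (card S) + E)"
        using fin uniform[OF jN] by (simp add: sum_distrib_right[symmetric] total_int_rate_def)
      also have "(\<Sum>k\<in>S. int_rate N k j * nonadoption (insert k S) s) \<le> (\<Sum>k\<in>S. \<kappa> * 1)"
        using \<kappa> nn S(2) jN nonadoption_le_1 nonadoption_nonneg by (intro sum_mono mult_mono) auto
      finally have "(\<Sum>k\<in>nodes N. int_rate N k j * nonadoption (insert k S) s) \<le> q * (y s ^ Suc (card S) + E) + ?n * \<kappa>"
        by simp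
      then show ?thesis
        using uniform[OF jN] by (simp add: rate_bound_def algebra_simps)
    qed
    have "\<forall>\<^sub>F h in at_right 0. \<forall>s\<ge>0. nonadoption S (s + h) \<le> nonadoption S s - h * ((\<Sum>j\<in>S. rate_bound S (nodes N) j s) - e / 2)"
      using fin S e by (intro nonadoption_step_le) auto
    moreover have "\<forall>\<^sub>F h in at_right 0. \<forall>s\<in>{0..t}.
       \<bar>y (s + h) ^ card S - (y s ^ card S + h * (- ?a * y s ^ card S + ?n * q * y s ^ Suc (card S)))\<bar> \<le> h * (e / 2)"
      using e by (intro bass_nonadoption_power_expansion p q) simp
    ultimately show "\<forall>\<^sub>F h in at_right 0. \<forall>s\<in>{0..t}. ?D (s + h) \<le> ?D s - h * (?a * ?D s - ?b - e)"
      using eventually_at_right_less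
    proof (eventually_elim, intro ballI)
      fix h s :: real
      assume nonadoption: "\<forall>s\<ge>0. nonadoption S (s + h) \<le> nonadoption S s - h * ((\<Sum>j\<in>S. rate_bound S (nodes N) j s) - e / 2)"
        and yy: "\<forall>s\<in>{0..t}. \<bar>y (s + h) ^ card S - (y s ^ card S + h * (- ?a * y s ^ card S + ?n * q * y s ^ Suc (card S)))\<bar> \<le> h * (e / 2)"
        and h: "0 < h" and s: "s \<in> {0..t}"
      have "?a * nonadoption S s - ?n * q * y s ^ Suc (card S) - ?b = (\<Sum>j\<in>S. (p + q) * nonadoption S s - q * y s ^ Suc (card S) - q * E - ?n * \<kappa>)"
        by (simp add: algebra_simps)
      also have "\<dots> \<le> (\<Sum>j\<in>S. rate_bound S (nodes N) j s)"
        using rb s by (intro sum_mono) auto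
      finally have "h * (?a * nonadoption S s - ?n * q * y s ^ Suc (card S) - ?b - e / 2)
          \<le> h * ((\<Sum>j\<in>S. rate_bound S (nodes N) j s) - e / 2)"
        using h by (intro mult_left_mono) auto
      moreover have "nonadoption S (s + h) \<le> nonadoption S s - h * ((\<Sum>j\<in>S. rate_bound S (nodes N) j s) - e / 2)"
        using nonadoption s by simp
      moreover have "y s ^ card S + h * (- ?a * y s ^ card S + ?n * q * y s ^ Suc (card S)) - h * (e / 2) \<le> y (s + h) ^ card S"
        using bspec[OF yy s] unfolding abs_le_iff by linarith
      ultimately have "?D (s + h) \<le> nonadoption S s - h * (?a * nonadoption S s - ?n * q * y s ^ Suc (card S) - ?b - e / 2)
         - (y s ^ card S + h * (- ?a * y s ^ card S + ?n * q * y s ^ Suc (card S)) - h * (e / 2))"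
        by linarith
      also have "\<dots> = ?D s - h * (?a * ?D s - ?b - e)"
        by (simp add: algebra_simps)
      finally show "?D (s + h) \<le> ?D s - h * (?a * ?D s - ?b - e)" .
    qed
  qed
  also have "?b / ?a = (q * E + ?n * \<kappa>) / (p + q)"
    using n by simp
  finally show ?thesis .
qed

text \<open>
  Each iteration enlarges the set by one node, so the error accumulated in \<open>i\<close> steps is
  of order \<open>i (n + i) \<kappa>\<close>. It grows with \<open>i\<close> but vanishes with \<open>\<kappa>\<close> for fixed \<open>i\<close>: first \<open>i\<close> is chosen,
  then \<open>\<kappa>\<close>.
\<close>

theorem nonadoption_le_power:
  fixes \<kappa> :: real
  assumes fin: "finite (nodes N)"
    and \<kappa>: "0 \<le> \<kappa>" "\<And>k j. k \<in> nodes N \<Longrightarrow> j \<in> nodes N \<Longrightarrow> int_rate N k j \<le> \<kappa>"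
    and "S \<noteq> {}" "S \<subseteq> nodes N" "0 \<le> t"
  shows "nonadoption S t \<le> y t ^ card S + (q / (p + q)) ^ i + i * (card S + i) * \<kappa> / (p + q)"
  using assms(4-)
proof (induction i arbitrary: S t)
  case 0
  have "0 \<le> y t ^ card S"
    using bass_nonadoption_bounds[OF p q 0(3)] by simp
  then show ?case using nonadoption_le_1[of S t] by simp
next
  case (Suc i)
  let ?r = "q / (p + q)" and ?n = "card S"
  have finS: "finite S" using fin Suc.prems finite_subset by blast
  let ?E = "?r ^ i + i * (Suc ?n + i) * \<kappa> / (p + q)"
  have "nonadoption S t - y t ^ ?n \<le> (q * ?E + ?n * \<kappa>) / (p + q)"
  proof (rule nonadoption_le_contract[OF fin \<kappa> Suc.prems(1,2) _ _ Suc.prems(3)])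
    show "0 \<le> ?E" using p q \<kappa>(1) by auto
    show "nonadoption (insert k S) t - y t ^ Suc ?n \<le> ?E" if "k \<in> nodes N - S" "0 \<le> t" for k t
      using Suc.IH[of "insert k S" t] that Suc.prems finS by (simp add: algebra_simps)
  qed
  also have "\<dots> = ?r * ?r ^ i + ?r * (i * (Suc ?n + i) * \<kappa> / (p + q)) + ?n * \<kappa> / (p + q)"
    using p q by (simp add: add_divide_distrib distrib_left)
  also have "?r * (i * (Suc ?n + i) * \<kappa> / (p + q)) \<le> 1 * (i * (Suc ?n + i) * \<kappa> / (p + q))"
    using p q \<kappa>(1) by (intro mult_right_mono) auto
  also have "?r * ?r ^ i + 1 * (i * (Suc ?n + i) * \<kappa> / (p + q)) + ?n * \<kappa> / (p + q)
      = ?r ^ Suc i + (i * (Suc ?n + i) + ?n) * \<kappa> / (p + q)"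
    by (simp add: add_divide_distrib distrib_right)
  also have "\<dots> \<le> ?r ^ Suc i + Suc i * (?n + Suc i) * \<kappa> / (p + q)"
    using p q \<kappa>(1) by (intro add_left_mono divide_right_mono mult_right_mono) (auto simp flip: of_nat_add of_nat_mult)
  finally show ?case by simp
qed

end

section \<open>The joint density of the adoption times\<close>

interpretation real_prod: product_sigma_finite "\<lambda>_. lborel :: real measure"
  by standard

lemma measurable_coord:
  "j \<in> S \<Longrightarrow> (\<lambda>T. T j) \<in> borel_measurable (PiM S (\<lambda>_. lborel :: real measure))"
  using measurable_component_singleton[of j S "\<lambda>_. lborel :: real measure"] by simp

text \<open>
  A population with rates, not tied to the record type of networks. The split of the density makes
  subpopulations with increased external rates appear; they are described by the set \<open>A\<close> of
  those who have already adopted and the set \<open>S\<close> of those who have not, with \<open>p\<close> and \<open>q\<close> fixed.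
\<close>

locale finite_rates =
  fixes V :: "'i set" and p :: "'i \<Rightarrow> real" and q :: "'i \<Rightarrow> 'i \<Rightarrow> real"
  assumes finite_V: "finite V"
    and p_pos: "j \<in> V \<Longrightarrow> 0 < p j"
    and q_nonneg: "k \<in> V \<Longrightarrow> j \<in> V \<Longrightarrow> 0 \<le> q k j"
begin

text \<open>
  The adoption rate of \<open>j\<close> when \<open>A\<close> is the set of adopters.
\<close>

definition rate_given :: "'i set \<Rightarrow> 'i \<Rightarrow> real" where
  "rate_given A j = p j + (\<Sum>a\<in>A. q a j)"

definition hazard :: "'i set \<Rightarrow> 'i set \<Rightarrow> ('i \<Rightarrow> real) \<Rightarrow> 'i \<Rightarrow> real" where
  "hazard A S T j = rate_given A j + (\<Sum>k\<in>S. q k j * of_bool (T k < T j))"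

text \<open>
  The integral over \<open>[s, T j]\<close> of the rate of \<open>j\<close>, if \<open>A\<close> has adopted before time \<open>s\<close> and every
  \<open>k \<in> S\<close> adopts at time \<open>T k \<ge> s\<close>.
\<close>

definition cum_hazard :: "'i set \<Rightarrow> 'i set \<Rightarrow> real \<Rightarrow> ('i \<Rightarrow> real) \<Rightarrow> 'i \<Rightarrow> real" where
  "cum_hazard A S s T j = rate_given A j * (T j - s) + (\<Sum>k\<in>S. q k j * max 0 (T j - T k))"

text \<open>
  The joint density of the adoption times of \<open>S\<close> for a process that starts at time \<open>s\<close> with
  adopters \<open>A\<close>. Carrying the starting time as a parameter makes translations of the multivariate
  Lebesgue measure superfluous.
\<close>

definition time_density :: "'i set \<Rightarrow> 'i set \<Rightarrow> real \<Rightarrow> ('i \<Rightarrow> real) \<Rightarrow> real" where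
  "time_density A S s T = (\<Prod>j\<in>S. of_bool (s < T j) * (hazard A S T j * exp (- cum_hazard A S s T j)))"

text \<open>
  The probability that no node of \<open>S\<close> adopts between \<open>s\<close> and \<open>u\<close>, if \<open>A\<close> has adopted before \<open>s\<close>
  and the nodes \<open>b \<in> B\<close> adopt at times \<open>T b\<close> in between.
\<close>

definition survival :: "'i set \<Rightarrow> 'i set \<Rightarrow> 'i set \<Rightarrow> real \<Rightarrow> real \<Rightarrow> ('i \<Rightarrow> real) \<Rightarrow> real" where
  "survival A B S s u T = exp (- (\<Sum>j\<in>S. rate_given A j * (u - s) + (\<Sum>b\<in>B. q b j * (u - T b))))"

lemma finite_sub: "A \<subseteq> V \<Longrightarrow> finite A"
  using finite_V finite_subset by blast

lemma rate_given_Un: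
  assumes "A \<subseteq> V" "B \<subseteq> V" "A \<inter> B = {}"
  shows "rate_given (A \<union> B) j = rate_given A j + (\<Sum>b\<in>B. q b j)"
  using assms by (simp add: rate_given_def sum.union_disjoint finite_sub)

lemma rate_given_pos: "A \<subseteq> V \<Longrightarrow> j \<in> V \<Longrightarrow> 0 < rate_given A j"
  unfolding rate_given_def by (intro add_pos_nonneg sum_nonneg p_pos q_nonneg) auto

lemma hazard_nonneg: "A \<subseteq> V \<Longrightarrow> S \<subseteq> V \<Longrightarrow> j \<in> V \<Longrightarrow> 0 \<le> hazard A S T j"
  unfolding hazard_def
  by (intro add_nonneg_nonneg sum_nonneg mult_nonneg_nonneg q_nonneg less_imp_le[OF rate_given_pos]) auto

lemma time_density_nonneg: "A \<subseteq> V \<Longrightarrow> S \<subseteq> V \<Longrightarrow> 0 \<le> time_density A S s T"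
  unfolding time_density_def by (intro prod_nonneg mult_nonneg_nonneg hazard_nonneg ballI) auto

lemma survival_nonneg: "0 \<le> survival A B S s u T"
  by (simp add: survival_def)

lemma time_density_cong:
  assumes "\<And>j. j \<in> S \<Longrightarrow> T j = T' j"
  shows "time_density A S s T = time_density A S s T'"
  unfolding time_density_def hazard_def cum_hazard_def
  by (intro prod.cong sum.cong arg_cong2[where f="(*)"] arg_cong2[where f="(+)"] refl
      arg_cong[where f=exp] arg_cong[where f=uminus] arg_cong[where f=of_bool])
     (simp_all add: assms)

lemma survival_cong:
  assumes "\<And>j. j \<in> B \<Longrightarrow> T j = T' j"
  shows "survival A B S s u T = survival A B S s u T'"
  unfolding survival_def by (simp add: assms)

lemma time_density_eq_0: "finite S \<Longrightarrow> j \<in> S \<Longrightarrow> T j \<le> s \<Longrightarrow> time_density A S s T = 0"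
  unfolding time_density_def by (rule prod_zero) (auto intro!: bexI[of _ j])

text \<open>
  The factorisation behind both the normalisation and the Markov property. Up to time \<open>u\<close> the nodes
  of \<open>S\<close> influence nobody; after \<open>u\<close> the nodes of \<open>B\<close> act at full strength. Each cumulative hazard
  of a node in \<open>S\<close> is therefore the sum of its part before \<open>u\<close>, collected in \<open>survival\<close>, and of
  the cumulative hazard of a process restarted at \<open>u\<close>.
\<close>

lemma time_density_split:
  assumes V: "A \<subseteq> V" "B \<subseteq> V" "S \<subseteq> V" and disj: "A \<inter> B = {}" "B \<inter> S = {}"
    and su: "s \<le> u" and B: "\<And>b. b \<in> B \<Longrightarrow> T b \<le> u" and S: "\<And>j. j \<in> S \<Longrightarrow> u < T j"
  shows "time_density A (B \<union> S) s T = time_density A B s T * survival A B S s u T * time_density (A \<union> B) S u T"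
proof -
  have fin: "finite A" "finite B" "finite S"
    using V finite_sub by auto
  have hB: "hazard A (B \<union> S) T j = hazard A B T j" if "j \<in> B" for j
  proof -
    have "(\<Sum>k\<in>S. q k j * of_bool (T k < T j)) = 0"
      using B[OF that] S by (intro sum.neutral) force
    then show ?thesis
      using fin disj by (simp add: hazard_def sum.union_disjoint del: sum_mult_of_bool_eq)
  qed
  have cB: "cum_hazard A (B \<union> S) s T j = cum_hazard A B s T j" if "j \<in> B" for j
  proof -
    have "(\<Sum>k\<in>S. q k j * max 0 (T j - T k)) = 0"
      using B[OF that] S by (intro sum.neutral) force
    then show ?thesis
      using fin disj by (simp add: cum_hazard_def sum.union_disjoint)
  qed
  have hS: "hazard A (B \<union> S) T j = hazard (A \<union> B) S T j" if "j \<in> S" for j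
  proof -
    have "(\<Sum>k\<in>B. q k j * of_bool (T k < T j)) = (\<Sum>k\<in>B. q k j)"
      using S[OF that] B by (intro sum.cong) force+
    then show ?thesis
      using fin disj V by (simp add: hazard_def sum.union_disjoint rate_given_Un del: sum_mult_of_bool_eq)
  qed
  have cS: "cum_hazard A (B \<union> S) s T j =
     (rate_given A j * (u - s) + (\<Sum>b\<in>B. q b j * (u - T b))) + cum_hazard (A \<union> B) S u T j"
    if "j \<in> S" for j
  proof -
    have "(\<Sum>k\<in>B. q k j * max 0 (T j - T k)) = (\<Sum>k\<in>B. q k j * (u - T k) + q k j * (T j - u))"
      using S[OF that] B by (intro sum.cong) (force simp: max_def algebra_simps)+
    then show ?thesis
      using fin disj V
      by (simp add: cum_hazard_def sum.union_disjoint rate_given_Un sum.distrib sum_subtractf sum_distrib_left algebra_simps)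
  qed
  have "time_density A (B \<union> S) s T =
     (\<Prod>j\<in>B. of_bool (s < T j) * (hazard A (B \<union> S) T j * exp (- cum_hazard A (B \<union> S) s T j))) *
     (\<Prod>j\<in>S. of_bool (s < T j) * (hazard A (B \<union> S) T j * exp (- cum_hazard A (B \<union> S) s T j)))"
    unfolding time_density_def using fin disj by (simp add: prod.union_disjoint)
  also have "(\<Prod>j\<in>B. of_bool (s < T j) * (hazard A (B \<union> S) T j * exp (- cum_hazard A (B \<union> S) s T j)))
      = time_density A B s T"
    unfolding time_density_def using hB cB by (intro prod.cong) auto
  also have "(\<Prod>j\<in>S. of_bool (s < T j) * (hazard A (B \<union> S) T j * exp (- cum_hazard A (B \<union> S) s T j)))
      = (\<Prod>j\<in>S. exp (- (rate_given A j * (u - s) + (\<Sum>b\<in>B. q b j * (u - T b)))) *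
            (of_bool (u < T j) * (hazard (A \<union> B) S T j * exp (- cum_hazard (A \<union> B) S u T j))))"
    using S su by (intro prod.cong) (force simp: hS cS exp_add[symmetric] algebra_simps)+
  also have "\<dots> = survival A B S s u T * time_density (A \<union> B) S u T"
    using fin by (simp add: prod.distrib survival_def time_density_def exp_sum sum_negf[symmetric])
  finally show ?thesis by (simp add: mult.assoc)
qed

lemma borel_time_density:
  assumes "S \<subseteq> S'"
  shows "time_density A S s \<in> borel_measurable (PiM S' (\<lambda>_. lborel))"
proof -
  have [measurable]: "(\<lambda>T. T j) \<in> borel_measurable (PiM S' (\<lambda>_. lborel :: real measure))" if "j \<in> S" for j
    using that assms by (auto intro: measurable_coord)
  show ?thesis
    unfolding time_density_def[abs_def] hazard_def cum_hazard_def by measurable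
qed

lemma borel_survival:
  assumes "B \<subseteq> S'"
  shows "survival A B S s u \<in> borel_measurable (PiM S' (\<lambda>_. lborel))"
proof -
  have [measurable]: "(\<lambda>T. T j) \<in> borel_measurable (PiM S' (\<lambda>_. lborel :: real measure))" if "j \<in> B" for j
    using that assms by (auto intro: measurable_coord)
  show ?thesis
    unfolding survival_def[abs_def] by measurable
qed

text \<open>
  Fubini for the factorisation: a factor \<open>f\<close> that depends on the past and a factor \<open>g\<close> that
  depends on the future integrate to a product.
\<close>

lemma nn_integral_split:
  assumes V: "A \<subseteq> V" "B \<subseteq> V" "S \<subseteq> V" and disj: "A \<inter> B = {}" "B \<inter> S = {}" and su: "s \<le> u"
    and f: "f \<in> borel_measurable (PiM B (\<lambda>_. lborel))"
    and g: "g \<in> borel_measurable (PiM S (\<lambda>_. lborel))"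
  shows "(\<integral>\<^sup>+T. ennreal (time_density A (B \<union> S) s T) *
             (of_bool (\<forall>b\<in>B. T b \<le> u) * of_bool (\<forall>j\<in>S. u < T j)) *
             (f (restrict T B) * g (restrict T S)) \<partial>PiM (B \<union> S) (\<lambda>_. lborel))
     = (\<integral>\<^sup>+x. ennreal (time_density A B s x * survival A B S s u x) * of_bool (\<forall>b\<in>B. x b \<le> u) * f x
           \<partial>PiM B (\<lambda>_. lborel)) *
       (\<integral>\<^sup>+y. ennreal (time_density (A \<union> B) S u y) * g y \<partial>PiM S (\<lambda>_. lborel))"
    (is "?L = ?F * ?G")
proof -
  have fin: "finite A" "finite B" "finite S"
    using V finite_sub by auto
  have [measurable]: "(\<lambda>T. restrict T B) \<in> PiM (B \<union> S) (\<lambda>_. lborel) \<rightarrow>\<^sub>M PiM B (\<lambda>_. lborel :: real measure)"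
    "(\<lambda>T. restrict T S) \<in> PiM (B \<union> S) (\<lambda>_. lborel) \<rightarrow>\<^sub>M PiM S (\<lambda>_. lborel :: real measure)"
    by (auto intro!: measurable_restrict_subset)
  have [measurable]: "Measurable.pred (PiM (B \<union> S) (\<lambda>_. lborel)) (\<lambda>T. \<forall>b\<in>B. T b \<le> u)"
     "Measurable.pred (PiM (B \<union> S) (\<lambda>_. lborel)) (\<lambda>T. \<forall>j\<in>S. u < T j)"
     "Measurable.pred (PiM B (\<lambda>_. lborel)) (\<lambda>T. \<forall>b\<in>B. T b \<le> u)"
    using fin by (auto intro!: pred_intros_finite)
  have "?L = (\<integral>\<^sup>+ x. (\<integral>\<^sup>+ y. ennreal (time_density A (B \<union> S) s (merge B S (x, y))) *
             (of_bool (\<forall>b\<in>B. merge B S (x, y) b \<le> u) * of_bool (\<forall>j\<in>S. u < merge B S (x, y) j)) *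
             (f (restrict (merge B S (x, y)) B) * g (restrict (merge B S (x, y)) S))
               \<partial>PiM S (\<lambda>_. lborel)) \<partial>PiM B (\<lambda>_. lborel))"
    using fin disj(2)
  proof (intro real_prod.product_nn_integral_fold)
    let ?M = "PiM (B \<union> S) (\<lambda>_. lborel :: real measure)"
    have 1: "(\<lambda>T. ennreal (time_density A (B \<union> S) s T)) \<in> borel_measurable ?M"
      by (intro measurable_compose[OF borel_time_density measurable_ennreal]) simp
    have 2: "(\<lambda>T. of_bool (\<forall>b\<in>B. T b \<le> u)) \<in> borel_measurable ?M"
       "(\<lambda>T. of_bool (\<forall>j\<in>S. u < T j)) \<in> borel_measurable ?M"
      by measurable
    have 3: "(\<lambda>T. f (restrict T B)) \<in> borel_measurable ?M" "(\<lambda>T. g (restrict T S)) \<in> borel_measurable ?M"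
      by (rule measurable_compose[OF _ f] measurable_compose[OF _ g], simp)+
    show "(\<lambda>T. ennreal (time_density A (B \<union> S) s T) *
             (of_bool (\<forall>b\<in>B. T b \<le> u) * of_bool (\<forall>j\<in>S. u < T j)) *
             (f (restrict T B) * g (restrict T S))) \<in> borel_measurable (PiM (B \<union> S) (\<lambda>_. lborel))"
      by (intro borel_measurable_times_ennreal 1 2 3)
  qed
  also have "\<dots> = (\<integral>\<^sup>+ x. (\<integral>\<^sup>+ y. (ennreal (time_density A B s x * survival A B S s u x) * of_bool (\<forall>b\<in>B. x b \<le> u) * f x) *
      (ennreal (time_density (A \<union> B) S u y) * g y)
               \<partial>PiM S (\<lambda>_. lborel)) \<partial>PiM B (\<lambda>_. lborel))"
  proof (intro nn_integral_cong)
    fix x y :: "'i \<Rightarrow> real"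
    assume x: "x \<in> space (PiM B (\<lambda>_. lborel))" and y: "y \<in> space (PiM S (\<lambda>_. lborel))"
    let ?T = "merge B S (x, y)"
    have TB: "?T b = x b" if "b \<in> B" for b
      using that by (simp add: merge_def)
    have TS: "?T j = y j" if "j \<in> S" for j
      using that disj by (auto simp add: merge_def)
    have rB: "restrict ?T B = x" and rS: "restrict ?T S = y"
      using x y TB TS by (auto simp: space_PiM PiE_def extensional_def restrict_def fun_eq_iff)
    have eqB: "(\<forall>b\<in>B. ?T b \<le> u) = (\<forall>b\<in>B. x b \<le> u)" and eqS: "(\<forall>j\<in>S. u < ?T j) = (\<forall>j\<in>S. u < y j)"
      using TB TS by auto
    show "ennreal (time_density A (B \<union> S) s ?T) * (of_bool (\<forall>b\<in>B. ?T b \<le> u) * of_bool (\<forall>j\<in>S. u < ?T j)) *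
             (f (restrict ?T B) * g (restrict ?T S))
         = (ennreal (time_density A B s x * survival A B S s u x) * of_bool (\<forall>b\<in>B. x b \<le> u) * f x) *
      (ennreal (time_density (A \<union> B) S u y) * g y)"
    proof (cases "(\<forall>b\<in>B. x b \<le> u) \<and> (\<forall>j\<in>S. u < y j)")
      case True
      have "time_density A (B \<union> S) s ?T = time_density A B s ?T * survival A B S s u ?T * time_density (A \<union> B) S u ?T"
        using True TB TS by (intro time_density_split V disj su) auto
      also have "time_density A B s ?T = time_density A B s x"
        by (intro time_density_cong TB)
      also have "survival A B S s u ?T = survival A B S s u x"
        by (intro survival_cong TB)
      also have "time_density (A \<union> B) S u ?T = time_density (A \<union> B) S u y"
        by (intro time_density_cong TS)
      finally have "ennreal (time_density A (B \<union> S) s ?T) =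
          ennreal (time_density A B s x * survival A B S s u x) * ennreal (time_density (A \<union> B) S u y)"
        using V by (simp add: ennreal_mult' time_density_nonneg survival_nonneg)
      then show ?thesis
        using True unfolding rB rS eqB eqS by (simp add: mult_ac)
    next
      case False
      then have "of_bool (\<forall>b\<in>B. x b \<le> u) * ennreal (time_density (A \<union> B) S u y) = 0"
        using fin time_density_eq_0[of S _ y u "A \<union> B"] by (cases "\<forall>b\<in>B. x b \<le> u") (auto simp: not_less)
      moreover have "of_bool (\<forall>b\<in>B. x b \<le> u) * of_bool (\<forall>j\<in>S. u < y j) = (0::ennreal)"
        using False by auto
      ultimately show ?thesis
        unfolding rB rS eqB eqS by (auto simp: mult.assoc)
    qed
  qed
  also have "\<dots> = (\<integral>\<^sup>+ x. (ennreal (time_density A B s x * survival A B S s u x) * of_bool (\<forall>b\<in>B. x b \<le> u) * f x) *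
      ?G \<partial>PiM B (\<lambda>_. lborel))"
    by (intro nn_integral_cong nn_integral_cmult borel_measurable_times_ennreal g
          measurable_compose[OF borel_time_density measurable_ennreal] subset_refl)
  also have "\<dots> = ?F * ?G"
  proof (intro nn_integral_multc borel_measurable_times_ennreal f)
    have "(\<lambda>x. time_density A B s x * survival A B S s u x) \<in> borel_measurable (PiM B (\<lambda>_. lborel))"
      by (intro borel_measurable_times borel_time_density borel_survival subset_refl)
    then show "(\<lambda>x. ennreal (time_density A B s x * survival A B S s u x)) \<in> borel_measurable (PiM B (\<lambda>_. lborel))"
      by (rule measurable_compose[OF _ measurable_ennreal])
  qed measurable
  finally show ?thesis .
qed

end

section \<open>Normalisation of the density\<close>

lemma AE_distinct_coord:
  fixes S :: "'i set"
  assumes S: "finite S" and ij: "i \<in> S" "j \<in> S" "i \<noteq> j"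
  shows "AE T in PiM S (\<lambda>_. lborel :: real measure). T i \<noteq> T j"
proof -
  let ?S = "S - {i}" and ?M = "\<lambda>S. PiM S (\<lambda>_. lborel :: real measure)"
  have S': "S = insert i ?S" "i \<notin> ?S" "finite ?S"
    using S ij by auto
  have [measurable]: "Measurable.pred (?M S) (\<lambda>T. T i = T j)"
    unfolding pred_def using ij by (intro borel_measurable_eq measurable_coord)
  have m: "(\<lambda>T. of_bool (T i = T j) :: ennreal) \<in> borel_measurable (?M S)"
    by measurable
  have "(\<integral>\<^sup>+T. of_bool (T i = T j) \<partial>?M S) = (\<integral>\<^sup>+x. (\<integral>\<^sup>+y. of_bool ((x(i := y)) i = (x(i := y)) j) \<partial>lborel) \<partial>?M ?S)"
    using m S' real_prod.product_nn_integral_insert[of ?S i "\<lambda>T. of_bool (T i = T j)"] by simp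
  also have "\<dots> = (\<integral>\<^sup>+x. 0 \<partial>?M ?S)"
  proof (intro nn_integral_cong)
    fix x :: "'i \<Rightarrow> real"
    have "(\<integral>\<^sup>+y. of_bool ((x(i := y)) i = (x(i := y)) j) \<partial>lborel) = (\<integral>\<^sup>+y. indicator {x j} y \<partial>lborel)"
      using ij by (intro nn_integral_cong) (auto simp: indicator_def)
    also have "\<dots> = 0"
      by simp
    finally show "(\<integral>\<^sup>+y. of_bool ((x(i := y)) i = (x(i := y)) j) \<partial>lborel) = 0" .
  qed
  finally have "(\<integral>\<^sup>+T. of_bool (T i = T j) \<partial>?M S) = 0"
    by simp
  then have "AE T in ?M S. of_bool (T i = T j) = (0 :: ennreal)"
    using m by (simp add: nn_integral_0_iff_AE)
  then show ?thesis
    by eventually_elim simp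
qed

text \<open>
  Ties have measure zero, so the events that a given node comes first form a partition almost
  everywhere.
\<close>

lemma AE_unique_first:
  fixes S :: "'i set"
  assumes S: "finite S" "S \<noteq> {}"
  shows "AE T in PiM S (\<lambda>_. lborel :: real measure).
           (\<Sum>j\<in>S. of_bool (\<forall>i\<in>S - {j}. T j < T i)) = (1 :: ennreal)"
proof -
  have "AE T in PiM S (\<lambda>_. lborel :: real measure). \<forall>i\<in>S. \<forall>j\<in>S. i \<noteq> j \<longrightarrow> T i \<noteq> T j"
  proof (intro AE_finite_allI AE_impI S(1))
    fix i j assume "i \<in> S" "j \<in> S" "i \<noteq> j"
    then show "AE T in PiM S (\<lambda>_. lborel :: real measure). T i \<noteq> T j"
      by (rule AE_distinct_coord[OF S(1)])
  qed
  then show ?thesis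
  proof eventually_elim
    fix T :: "'i \<Rightarrow> real"
    assume inj: "\<forall>i\<in>S. \<forall>j\<in>S. i \<noteq> j \<longrightarrow> T i \<noteq> T j"
    define m where "m = arg_min_on T S"
    have m: "m \<in> S" "\<And>i. i \<in> S \<Longrightarrow> T m \<le> T i"
      using S arg_min_if_finite[of S T] arg_min_least[of S _ T] by (auto simp: m_def)
    have "(\<forall>i\<in>S - {j}. T j < T i) \<longleftrightarrow> j = m" if "j \<in> S" for j
      using m inj that by (metis DiffE DiffI insertI1 insert_iff empty_iff leD order_le_less)
    then have "(\<Sum>j\<in>S. of_bool (\<forall>i\<in>S - {j}. T j < T i)) = (\<Sum>j\<in>S. if j = m then 1 else (0 :: ennreal))"
      by (intro sum.cong) auto
    then show "(\<Sum>j\<in>S. of_bool (\<forall>i\<in>S - {j}. T j < T i)) = (1 :: ennreal)"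
      using S m by simp
  qed
qed

lemma nn_integral_exp_tail:
  assumes R: "0 < R" and r: "0 \<le> r"
  shows "(\<integral>\<^sup>+y. ennreal (of_bool (s < y) * (r * exp (- (R * (y - s))))) \<partial>lborel) = ennreal (r / R)"
proof -
  have "(\<integral>\<^sup>+y. ennreal (of_bool (s < y) * (r * exp (- (R * (y - s))))) \<partial>lborel)
     = (\<integral>\<^sup>+y. ennreal (r * exp (- (R * (y - s)))) * indicator {s..} y \<partial>lborel)"
    using AE_lborel_singleton[of s]
    by (intro nn_integral_cong_AE) (auto elim!: eventually_mono simp: indicator_def)
  also have "\<dots> = ennreal (0 - (- (r / R) * exp (- (R * (s - s)))))"
  proof (rule nn_integral_FTC_atLeast[where F="\<lambda>y. - (r / R) * exp (- (R * (y - s)))"])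
    show "((\<lambda>y. - (r / R) * exp (- (R * (y - s)))) \<longlongrightarrow> 0) at_top"
    proof -
      have "filterlim (\<lambda>y. R * (y - s)) at_top at_top"
        using R by (intro filterlim_tendsto_pos_mult_at_top[OF tendsto_const]
              filterlim_tendsto_add_at_top[OF tendsto_const filterlim_ident, of "-s", simplified])
      then have "((\<lambda>y. exp (- (R * (y - s)))) \<longlongrightarrow> 0) at_top"
        by (intro filterlim_compose[OF exp_at_bot] filterlim_compose[OF filterlim_uminus_at_bot_at_top])
      then show ?thesis
        using tendsto_mult[OF tendsto_const, of _ 0 at_top "- (r / R)"] by simp
    qed
    show "((\<lambda>y. - (r / R) * exp (- (R * (y - s)))) has_real_derivative r * exp (- (R * (x - s)))) (at x)" for x
      using R by (auto intro!: derivative_eq_intros simp: field_simps)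
  qed (use r in auto)
  finally show ?thesis by simp
qed

context finite_rates begin

text \<open>
  Induction on the number of nodes, by cases on who adopts first. If this is \<open>j\<close>, at time \<open>y\<close>,
  the density splits at \<open>u = y\<close>; the other nodes integrate to \<open>1\<close> by the induction hypothesis, and
  there remains the density of an exponential race with total rate \<open>R\<close>, which \<open>j\<close> wins with
  probability \<open>rate_given A j / R\<close>.
\<close>

lemma nn_integral_time_density:
  assumes "A \<subseteq> V" "S \<subseteq> V" "A \<inter> S = {}"
  shows "(\<integral>\<^sup>+T. ennreal (time_density A S s T) \<partial>PiM S (\<lambda>_. lborel)) = 1"
  using assms
proof (induction "card S" arbitrary: A S s rule: less_induct)
  case less
  let ?M = "\<lambda>S. PiM S (\<lambda>_. lborel :: real measure)"
  have fin: "finite S"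
    using less.prems finite_sub by auto
  show ?case
  proof (cases "S = {}")
    case True
    show ?thesis
      unfolding True by (subst real_prod.nn_integral_empty) (simp_all add: time_density_def)
  next
    case False
    define R where "R = (\<Sum>j\<in>S. rate_given A j)"
    have R: "0 < R"
      unfolding R_def using less.prems fin False by (intro sum_pos rate_given_pos) auto
    have m: "(\<lambda>T. ennreal (time_density A S s T)) \<in> borel_measurable (?M S)"
      by (intro measurable_compose[OF borel_time_density measurable_ennreal] subset_refl)
    have m1: "(\<lambda>T. of_bool (\<forall>i\<in>S - {j}. T j < T i) :: ennreal) \<in> borel_measurable (?M S)" if "j \<in> S" for j
    proof -
      have "Measurable.pred (?M S) (\<lambda>T. \<forall>i\<in>S - {j}. T j < T i)"
        using fin that by (intro pred_intros_finite) (auto intro!: borel_measurable_less measurable_coord)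
      then show ?thesis by measurable
    qed
    have first: "(\<integral>\<^sup>+T. ennreal (time_density A S s T) * of_bool (\<forall>i\<in>S - {j}. T j < T i) \<partial>?M S) = ennreal (rate_given A j / R)"
      if j: "j \<in> S" for j
    proof -
      let ?S = "S - {j}"
      have S': "S = insert j ?S" "j \<notin> ?S" "finite ?S" "S = {j} \<union> ?S"
        using fin j by auto
      let ?c = "\<lambda>y. of_bool (s < y) * (rate_given A j * exp (- (R * (y - s))))"
      have c: "time_density A {j} s x * survival A {j} ?S s (x j) x = ?c (x j)" for x
        using fin j
        by (auto simp: time_density_def survival_def hazard_def cum_hazard_def R_def sum.remove[of S j]
            exp_add[symmetric] sum_distrib_left sum_subtractf algebra_simps)
      have "(\<integral>\<^sup>+T. ennreal (time_density A S s T) * of_bool (\<forall>i\<in>?S. T j < T i) \<partial>?M S)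
         = (\<integral>\<^sup>+y. (\<integral>\<^sup>+x. ennreal (time_density A S s (x(j := y))) * of_bool (\<forall>i\<in>?S. (x(j := y)) j < (x(j := y)) i) \<partial>?M ?S) \<partial>lborel)"
        by (rule real_prod.product_nn_integral_insert_rev[of ?S j, unfolded S'(1)[symmetric],
              OF S'(3,2) borel_measurable_times_ennreal[OF m m1[OF j]]])
      also have "\<dots> = (\<integral>\<^sup>+y. (\<integral>\<^sup>+x. ennreal (?c y) * ennreal (time_density (insert j A) ?S y x) \<partial>?M ?S) \<partial>lborel)"
      proof (intro nn_integral_cong)
        fix y :: real and x :: "'i \<Rightarrow> real"
        let ?T = "x(j := y)"
        have eq: "time_density (insert j A) ?S y ?T = time_density (insert j A) ?S y x"
          by (intro time_density_cong) auto
        show "ennreal (time_density A S s ?T) * of_bool (\<forall>i\<in>?S. ?T j < ?T i) = ennreal (?c y) * ennreal (time_density (insert j A) ?S y x)"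
        proof (cases "s < y \<and> (\<forall>i\<in>?S. y < x i)")
          case True
          have "time_density A ({j} \<union> ?S) s ?T = time_density A {j} s ?T * survival A {j} ?S s y ?T * time_density (A \<union> {j}) ?S y ?T"
            using less.prems j True by (intro time_density_split) auto
          then have "time_density A S s ?T = ?c y * time_density (insert j A) ?S y x"
            using c[of ?T] S'(4) eq by simp
          moreover have "0 \<le> time_density (insert j A) ?S y x" "0 < rate_given A j"
            using less.prems j by (auto intro!: time_density_nonneg rate_given_pos)
          ultimately show ?thesis
            using True by (simp add: ennreal_mult[symmetric])
        next
          case False
          then consider "y \<le> s" | i where "i \<in> ?S" "x i \<le> y"
            by (auto simp: not_less)
          then show ?thesis
          proof cases
            case 1
            then have "time_density A S s ?T = 0"
              using fin j by (intro time_density_eq_0[of _ j]) auto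
            then show ?thesis using 1 by simp
          next
            case (2 i)
            then have "time_density (insert j A) ?S y x = 0"
              using fin by (intro time_density_eq_0[of _ i]) auto
            moreover have "\<not> (\<forall>i\<in>?S. ?T j < ?T i)"
              using 2 by (auto intro!: bexI[of _ i])
            ultimately show ?thesis by simp
          qed
        qed
      qed
      also have "\<dots> = (\<integral>\<^sup>+y. ennreal (?c y) \<partial>lborel)"
      proof (intro nn_integral_cong)
        fix y :: real
        have "(\<integral>\<^sup>+x. ennreal (time_density (insert j A) ?S y x) \<partial>?M ?S) = 1"
          using less.prems j fin by (intro less.hyps psubset_card_mono) auto
        then show "(\<integral>\<^sup>+x. ennreal (?c y) * ennreal (time_density (insert j A) ?S y x) \<partial>?M ?S) = ennreal (?c y)"
          by (subst nn_integral_cmult)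
             (simp_all add: measurable_compose[OF borel_time_density measurable_ennreal])
      qed
      also have "\<dots> = ennreal (rate_given A j / R)"
        using less.prems j rate_given_pos[of A j] by (intro nn_integral_exp_tail R) auto
      finally show ?thesis .
    qed
    have "(\<integral>\<^sup>+T. ennreal (time_density A S s T) \<partial>?M S)
        = (\<integral>\<^sup>+T. (\<Sum>j\<in>S. ennreal (time_density A S s T) * of_bool (\<forall>i\<in>S - {j}. T j < T i)) \<partial>?M S)"
      using AE_unique_first[OF fin False]
      by (intro nn_integral_cong_AE) (auto elim!: eventually_mono simp: sum_distrib_left[symmetric])
    also have "\<dots> = (\<Sum>j\<in>S. \<integral>\<^sup>+T. ennreal (time_density A S s T) * of_bool (\<forall>i\<in>S - {j}. T j < T i) \<partial>?M S)"
      by (intro nn_integral_sum borel_measurable_times_ennreal m m1)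
    also have "\<dots> = (\<Sum>j\<in>S. ennreal (rate_given A j / R))"
      by (intro sum.cong first refl)
    also have "\<dots> = ennreal (\<Sum>j\<in>S. rate_given A j / R)"
      using R less.prems rate_given_pos[of A] by (intro sum_ennreal) (auto intro!: divide_nonneg_pos less_imp_le)
    also have "(\<Sum>j\<in>S. rate_given A j / R) = 1"
      using R by (simp add: sum_divide_distrib[symmetric] R_def)
    finally show ?thesis by simp
  qed
qed

end

section \<open>Adoptions in a short time\<close>

lemma nn_integral_box:
  assumes "finite D" "s \<le> u"
  shows "(\<integral>\<^sup>+x. ennreal c * indicator (PiE D (\<lambda>_. {s<..u})) x \<partial>PiM D (\<lambda>_. lborel)) = ennreal c * ennreal ((u - s) ^ card D)"
proof -
  have "(\<integral>\<^sup>+x. ennreal c * indicator (PiE D (\<lambda>_. {s<..u})) x \<partial>PiM D (\<lambda>_. lborel))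
     = ennreal c * emeasure (PiM D (\<lambda>_. lborel)) (PiE D (\<lambda>_. {s<..u}))"
    using assms by (intro nn_integral_cmult_indicator sets_PiM_I_finite) auto
  also have "emeasure (PiM D (\<lambda>_. lborel)) (PiE D (\<lambda>_. {s<..u})) = ennreal ((u - s) ^ card D)"
    using assms by (subst real_prod.emeasure_PiM) (auto simp: prod_constant ennreal_power)
  finally show ?thesis .
qed

lemma pred_set_of_finite:
  assumes S: "finite S" and X: "\<And>j. j \<in> S \<Longrightarrow> Measurable.pred M (X j)"
  shows "Measurable.pred M (\<lambda>\<omega>. Q {j \<in> S. X j \<omega>})"
proof -
  have eq: "Q {j \<in> S. X j \<omega>} \<longleftrightarrow> (\<exists>D\<in>{D \<in> Pow S. Q D}. \<forall>j\<in>S. X j \<omega> = (j \<in> D))" for \<omega>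
  proof
    assume "Q {j \<in> S. X j \<omega>}"
    then show "\<exists>D\<in>{D \<in> Pow S. Q D}. \<forall>j\<in>S. X j \<omega> = (j \<in> D)"
      by (intro bexI[of _ "{j \<in> S. X j \<omega>}"]) auto
  next
    assume "\<exists>D\<in>{D \<in> Pow S. Q D}. \<forall>j\<in>S. X j \<omega> = (j \<in> D)"
    then obtain D where D: "D \<subseteq> S" "Q D" "\<forall>j\<in>S. X j \<omega> = (j \<in> D)" by auto
    then have "{j \<in> S. X j \<omega>} = D" by auto
    with D show "Q {j \<in> S. X j \<omega>}" by simp
  qed
  have p: "Measurable.pred M (\<lambda>\<omega>. X j \<omega> = (j \<in> D))" if "j \<in> S" for j D
  proof -
    note X[OF that, measurable]
    show ?thesis by measurable
  qed
  show ?thesis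
    unfolding eq using S by (intro pred_intros_finite p) auto
qed

lemma pred_coord_le:
  assumes "j \<in> S"
  shows "Measurable.pred (PiM S (\<lambda>_. lborel :: real measure)) (\<lambda>y. y j \<le> u)"
proof -
  have [measurable]: "(\<lambda>y. y j) \<in> borel_measurable (PiM S (\<lambda>_. lborel :: real measure))"
    using measurable_component_singleton[of j S "\<lambda>_. lborel :: real measure"] assms by simp
  show ?thesis by measurable
qed

context finite_rates begin

definition times_law :: "'i set \<Rightarrow> 'i set \<Rightarrow> real \<Rightarrow> ('i \<Rightarrow> real) measure" where
  "times_law A S s = density (PiM S (\<lambda>_. lborel)) (\<lambda>T. ennreal (time_density A S s T))"

lemma sets_times_law[simp, measurable_cong]: "sets (times_law A S s) = sets (PiM S (\<lambda>_. lborel))"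
  and space_times_law[simp]: "space (times_law A S s) = space (PiM S (\<lambda>_. lborel))"
  by (simp_all add: times_law_def)

lemma borel_ennreal_time_density: "(\<lambda>T. ennreal (time_density A S s T)) \<in> borel_measurable (PiM S (\<lambda>_. lborel))"
  by (intro measurable_compose[OF borel_time_density measurable_ennreal] subset_refl)

lemma prob_space_times_law:
  assumes "A \<subseteq> V" "S \<subseteq> V" "A \<inter> S = {}"
  shows "prob_space (times_law A S s)"
proof
  have "emeasure (times_law A S s) (space (PiM S (\<lambda>_. lborel)))
      = (\<integral>\<^sup>+T. ennreal (time_density A S s T) * indicator (space (PiM S (\<lambda>_. lborel))) T \<partial>PiM S (\<lambda>_. lborel))"
    unfolding times_law_def by (intro emeasure_density borel_ennreal_time_density) simp
  also have "\<dots> = (\<integral>\<^sup>+T. ennreal (time_density A S s T) \<partial>PiM S (\<lambda>_. lborel))"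
    by (intro nn_integral_cong) simp
  finally show "emeasure (times_law A S s) (space (times_law A S s)) = 1"
    using nn_integral_time_density[OF assms] by simp
qed

lemma sets_adopters:
  assumes "finite S"
  shows "{y \<in> space (PiM S (\<lambda>_. lborel)). Q {j \<in> S. y j \<le> u}} \<in> sets (PiM S (\<lambda>_. lborel :: real measure))"
  using pred_set_of_finite[OF assms pred_coord_le, where Q = Q] by (simp add: pred_def)

lemma measure_times_law_adopters:
  assumes "A \<subseteq> V" "S \<subseteq> V" "A \<inter> S = {}"
  shows "measure (times_law A S s) {y \<in> space (times_law A S s). Q {j \<in> S. y j \<le> u}}
     = (\<Sum>D | D \<subseteq> S \<and> Q D. measure (times_law A S s) {y \<in> space (times_law A S s). {j \<in> S. y j \<le> u} = D})"
proof -
  interpret prob_space "times_law A S s" by (rule prob_space_times_law[OF assms])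
  have fin: "finite S" using assms finite_sub by auto
  have eq: "{y \<in> space (times_law A S s). Q {j \<in> S. y j \<le> u}}
      = (\<Union>D\<in>{D. D \<subseteq> S \<and> Q D}. {y \<in> space (times_law A S s). {j \<in> S. y j \<le> u} = D})"
    by auto
  have "measure (times_law A S s) (\<Union>D\<in>{D. D \<subseteq> S \<and> Q D}. {y \<in> space (times_law A S s). {j \<in> S. y j \<le> u} = D})
      = (\<Sum>D | D \<subseteq> S \<and> Q D. measure (times_law A S s) {y \<in> space (times_law A S s). {j \<in> S. y j \<le> u} = D})"
  proof (rule finite_measure_finite_Union)
    show "finite {D. D \<subseteq> S \<and> Q D}"
      using fin by (intro finite_subset[OF _ finite_Pow_iff[THEN iffD2]]) auto
    show "(\<lambda>D. {y \<in> space (times_law A S s). {j \<in> S. y j \<le> u} = D}) ` {D. D \<subseteq> S \<and> Q D} \<subseteq> events"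
      using sets_adopters[OF fin] by auto
    show "disjoint_family_on (\<lambda>D. {y \<in> space (times_law A S s). {j \<in> S. y j \<le> u} = D}) {D. D \<subseteq> S \<and> Q D}"
      by (auto simp: disjoint_family_on_def)
  qed
  then show ?thesis
    by (rule trans[OF arg_cong[where f="measure (times_law A S s)", OF eq]])
qed

text \<open>
  The split with trivial \<open>f\<close> and \<open>g\<close>: the nodes that have not adopted by \<open>u\<close> integrate to \<open>1\<close>.
\<close>

lemma emeasure_times_law_eq_adopters:
  assumes V: "A \<subseteq> V" "S \<subseteq> V" and disj: "A \<inter> S = {}" and D: "D \<subseteq> S" and su: "s \<le> u"
  shows "emeasure (times_law A S s) {y \<in> space (times_law A S s). {j \<in> S. y j \<le> u} = D}
    = (\<integral>\<^sup>+x. ennreal (time_density A D s x * survival A D (S - D) s u x) * of_bool (\<forall>b\<in>D. x b \<le> u) \<partial>PiM D (\<lambda>_. lborel))"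
proof -
  have fin: "finite S" using V finite_sub by auto
  have S: "D \<union> (S - D) = S" using D by auto
  have "emeasure (times_law A S s) {y \<in> space (times_law A S s). {j \<in> S. y j \<le> u} = D}
      = (\<integral>\<^sup>+y. ennreal (time_density A S s y) * indicator {y \<in> space (PiM S (\<lambda>_. lborel)). {j \<in> S. y j \<le> u} = D} y
            \<partial>PiM S (\<lambda>_. lborel))"
    unfolding times_law_def space_density by (intro emeasure_density borel_ennreal_time_density sets_adopters fin)
  also have "\<dots> = (\<integral>\<^sup>+T. ennreal (time_density A (D \<union> (S - D)) s T) *
             (of_bool (\<forall>b\<in>D. T b \<le> u) * of_bool (\<forall>j\<in>S - D. u < T j)) * (1 * 1) \<partial>PiM (D \<union> (S - D)) (\<lambda>_. lborel))"
  proof (unfold S, intro nn_integral_cong)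
    fix T :: "'i \<Rightarrow> real" assume T: "T \<in> space (PiM S (\<lambda>_. lborel))"
    have "{j \<in> S. T j \<le> u} = D \<longleftrightarrow> (\<forall>b\<in>D. T b \<le> u) \<and> (\<forall>j\<in>S - D. u < T j)"
      unfolding set_eq_iff using D by (auto simp: not_le; meson DiffI linorder_not_le)
    then show "ennreal (time_density A S s T) * indicator {y \<in> space (PiM S (\<lambda>_. lborel)). {j \<in> S. y j \<le> u} = D} T
       = ennreal (time_density A S s T) * (of_bool (\<forall>b\<in>D. T b \<le> u) * of_bool (\<forall>j\<in>S - D. u < T j)) * (1 * 1)"
      using T by (simp add: indicator_def)
  qed
  also have "\<dots> = (\<integral>\<^sup>+x. ennreal (time_density A D s x * survival A D (S - D) s u x) * of_bool (\<forall>b\<in>D. x b \<le> u) * 1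
           \<partial>PiM D (\<lambda>_. lborel)) *
       (\<integral>\<^sup>+y. ennreal (time_density (A \<union> D) (S - D) u y) * 1 \<partial>PiM (S - D) (\<lambda>_. lborel))"
    using V disj D by (intro nn_integral_split su) auto
  also have "(\<integral>\<^sup>+y. ennreal (time_density (A \<union> D) (S - D) u y) * 1 \<partial>PiM (S - D) (\<lambda>_. lborel)) = 1"
    using nn_integral_time_density[of "A \<union> D" "S - D" u] V disj D by auto
  finally show ?thesis by simp
qed

text \<open>
  A crude common bound for every adoption rate and for the sum of the rates of any set of nodes.
\<close>

definition max_rate :: real where
  "max_rate = (\<Sum>j\<in>V. p j + (\<Sum>k\<in>V. q k j))"

lemma rate_sum_le:
  assumes "S \<subseteq> V"
  shows "(\<Sum>j\<in>S. p j + (\<Sum>k\<in>V. q k j)) \<le> max_rate"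
  unfolding max_rate_def using assms finite_V
  by (intro sum_mono2) (auto intro!: add_nonneg_nonneg sum_nonneg q_nonneg less_imp_le[OF p_pos])

lemma max_rate_nonneg: "0 \<le> max_rate"
  using rate_sum_le[of "{}"] by simp

lemma rate_le:
  assumes "j \<in> V" shows "p j + (\<Sum>k\<in>V. q k j) \<le> max_rate"
  using rate_sum_le[of "{j}"] assms by simp

lemma rate_given_le:
  assumes "A \<subseteq> V" "j \<in> V" shows "rate_given A j \<le> p j + (\<Sum>k\<in>V. q k j)"
  unfolding rate_given_def using assms finite_V by (auto intro!: sum_mono2 q_nonneg)

lemma hazard_le:
  assumes "A \<subseteq> V" "D \<subseteq> V" "A \<inter> D = {}" "j \<in> V"
  shows "hazard A D T j \<le> max_rate"
proof -
  have "(\<Sum>k\<in>D. q k j * of_bool (T k < T j)) \<le> (\<Sum>k\<in>D. q k j)"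
    using assms by (intro sum_mono) (auto intro: q_nonneg)
  then have "hazard A D T j \<le> rate_given (A \<union> D) j"
    using assms by (simp add: hazard_def rate_given_Un)
  also have "\<dots> \<le> max_rate"
    using assms by (intro order_trans[OF rate_given_le rate_le]) auto
  finally show ?thesis .
qed

lemma time_density_le:
  assumes V: "A \<subseteq> V" "D \<subseteq> V" "A \<inter> D = {}"
  shows "time_density A D s T \<le> max_rate ^ card D"
proof -
  have "time_density A D s T \<le> (\<Prod>j\<in>D. max_rate)"
    unfolding time_density_def
  proof (intro prod_mono conjI)
    fix j assume j: "j \<in> D"
    let ?f = "of_bool (s < T j) * (hazard A D T j * exp (- cum_hazard A D s T j))"
    have h: "0 \<le> hazard A D T j" "hazard A D T j \<le> max_rate"
      using V j by (auto intro!: hazard_nonneg hazard_le)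
    then show "0 \<le> ?f" by simp
    show "?f \<le> max_rate"
    proof (cases "s < T j")
      case True
      have "0 \<le> cum_hazard A D s T j"
        unfolding cum_hazard_def using V j True rate_given_pos[of A j]
        by (intro add_nonneg_nonneg sum_nonneg mult_nonneg_nonneg q_nonneg) auto
      then have "hazard A D T j * exp (- cum_hazard A D s T j) \<le> max_rate * 1"
        using h max_rate_nonneg by (intro mult_mono) auto
      then show ?thesis using True by simp
    qed (use max_rate_nonneg in simp)
  qed
  then show ?thesis by simp
qed

lemma survival_le_1:
  assumes V: "A \<subseteq> V" "D \<subseteq> V" "S \<subseteq> V" and su: "s \<le> u" and T: "\<And>b. b \<in> D \<Longrightarrow> T b \<le> u"
  shows "survival A D S s u T \<le> 1"
proof -
  have "0 \<le> rate_given A j * (u - s) + (\<Sum>b\<in>D. q b j * (u - T b))" if "j \<in> S" for j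
    using V su T that rate_given_pos[of A j]
    by (intro add_nonneg_nonneg sum_nonneg mult_nonneg_nonneg q_nonneg) auto
  then have "0 \<le> (\<Sum>j\<in>S. rate_given A j * (u - s) + (\<Sum>b\<in>D. q b j * (u - T b)))"
    by (rule sum_nonneg)
  then show ?thesis by (simp add: survival_def)
qed

text \<open>
  The density of the adopters is at most \<open>max_rate\<close> for each of them, on a box with
  sides \<open>u - s\<close>.
\<close>

lemma measure_times_law_eq_adopters_le:
  assumes V: "A \<subseteq> V" "S \<subseteq> V" and disj: "A \<inter> S = {}" and D: "D \<subseteq> S" and su: "s \<le> u"
  shows "measure (times_law A S s) {y \<in> space (times_law A S s). {j \<in> S. y j \<le> u} = D} \<le> (max_rate * (u - s)) ^ card D"
proof -
  interpret prob_space "times_law A S s" by (rule prob_space_times_law[OF V disj])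
  have fin: "finite D" using V D finite_sub by auto
  have "emeasure (times_law A S s) {y \<in> space (times_law A S s). {j \<in> S. y j \<le> u} = D}
     \<le> (\<integral>\<^sup>+x. ennreal (max_rate ^ card D) * indicator (PiE D (\<lambda>_. {s<..u})) x \<partial>PiM D (\<lambda>_. lborel))"
    unfolding emeasure_times_law_eq_adopters[OF V disj D su]
  proof (intro nn_integral_mono)
    fix x :: "'i \<Rightarrow> real" assume x: "x \<in> space (PiM D (\<lambda>_. lborel))"
    show "ennreal (time_density A D s x * survival A D (S - D) s u x) * of_bool (\<forall>b\<in>D. x b \<le> u)
        \<le> ennreal (max_rate ^ card D) * indicator (PiE D (\<lambda>_. {s<..u})) x"
    proof (cases "\<forall>b\<in>D. s < x b \<and> x b \<le> u")
      case True
      have "time_density A D s x * survival A D (S - D) s u x \<le> max_rate ^ card D * 1"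
        using V D disj su True max_rate_nonneg
        by (intro mult_mono time_density_le survival_le_1 survival_nonneg) auto
      moreover have "x \<in> PiE D (\<lambda>_. {s<..u})"
        using x True by (auto simp: space_PiM PiE_def)
      ultimately show ?thesis using True by (simp add: ennreal_leI)
    next
      case False
      then have "time_density A D s x = 0 \<or> \<not> (\<forall>b\<in>D. x b \<le> u)"
        using fin by (auto intro!: time_density_eq_0 simp: not_less)
      then show ?thesis by auto
    qed
  qed
  also have "\<dots> = ennreal ((max_rate * (u - s)) ^ card D)"
    using fin su max_rate_nonneg by (simp add: nn_integral_box ennreal_mult[symmetric] power_mult_distrib)
  finally show ?thesis
    using su max_rate_nonneg by (subst ennreal_le_iff[symmetric]) (auto simp: emeasure_eq_measure)
qed

lemma measure_times_law_eq_adopters_le_square: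
  assumes V: "A \<subseteq> V" "S \<subseteq> V" and disj: "A \<inter> S = {}" and D: "D \<subseteq> S" "2 \<le> card D" and su: "s \<le> u"
  shows "measure (times_law A S s) {y \<in> space (times_law A S s). {j \<in> S. y j \<le> u} = D} \<le> (max_rate * (u - s))\<^sup>2"
proof (cases "max_rate * (u - s) \<le> 1")
  case True
  have "measure (times_law A S s) {y \<in> space (times_law A S s). {j \<in> S. y j \<le> u} = D} \<le> (max_rate * (u - s)) ^ card D"
    by (rule measure_times_law_eq_adopters_le) fact+
  also have "\<dots> \<le> (max_rate * (u - s))\<^sup>2"
    using True su max_rate_nonneg D by (intro power_decreasing) auto
  finally show ?thesis .
next
  \<comment> \<open>For long times the bound exceeds every probability.\<close>
  case False
  interpret prob_space "times_law A S s" by (rule prob_space_times_law[OF V disj])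
  have "1 \<le> (max_rate * (u - s))\<^sup>2"
    using False by (intro one_le_power) auto
  then show ?thesis
    using prob_le_1 order_trans by blast
qed

lemma sum_measure_times_law_le:
  assumes V: "A \<subseteq> V" "S \<subseteq> V" and disj: "A \<inter> S = {}" and su: "s \<le> u"
    and F: "F \<subseteq> Pow S" "\<And>D. D \<in> F \<Longrightarrow> 2 \<le> card D"
  shows "(\<Sum>D\<in>F. measure (times_law A S s) {y \<in> space (times_law A S s). {j \<in> S. y j \<le> u} = D})
    \<le> 2 ^ card V * (max_rate * (u - s))\<^sup>2"
proof -
  have "(\<Sum>D\<in>F. measure (times_law A S s) {y \<in> space (times_law A S s). {j \<in> S. y j \<le> u} = D}) \<le> (\<Sum>D\<in>F. (max_rate * (u - s))\<^sup>2)"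
    using F by (intro sum_mono measure_times_law_eq_adopters_le_square V disj su) auto
  also have "\<dots> = card F * (max_rate * (u - s))\<^sup>2"
    by simp
  also have "\<dots> \<le> 2 ^ card V * (max_rate * (u - s))\<^sup>2"
  proof (intro mult_right_mono)
    have "card F \<le> card (Pow V)"
      using F(1) V(2) finite_V by (intro card_mono) (auto dest: subsetD)
    then show "real (card F) \<le> 2 ^ card V"
      using finite_V by (simp add: card_Pow flip: of_nat_le_iff)
  qed simp
  finally show ?thesis .
qed

text \<open>
  At least two adoptions in a short time have probability of second order; in particular there are no
  joint adoptions. The number of possible sets of adopters is at most \<open>2 ^ card V\<close>.
\<close>

lemma measure_times_law_joint_le:
  assumes V: "A \<subseteq> V" "S \<subseteq> V" and disj: "A \<inter> S = {}" and ij: "i \<in> S" "j \<in> S" "i \<noteq> j" and su: "s \<le> u"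
  shows "measure (times_law A S s) {y \<in> space (times_law A S s). y i \<le> u \<and> y j \<le> u} \<le> 2 ^ card V * (max_rate * (u - s))\<^sup>2"
proof -
  have "measure (times_law A S s) {y \<in> space (times_law A S s). y i \<le> u \<and> y j \<le> u}
      = measure (times_law A S s) {y \<in> space (times_law A S s). i \<in> {j \<in> S. y j \<le> u} \<and> j \<in> {j \<in> S. y j \<le> u}}"
    using ij by simp
  also have "\<dots> = (\<Sum>D | D \<subseteq> S \<and> (i \<in> D \<and> j \<in> D).
     measure (times_law A S s) {y \<in> space (times_law A S s). {j \<in> S. y j \<le> u} = D})"
    by (rule measure_times_law_adopters[OF V disj])
  also have "\<dots> \<le> 2 ^ card V * (max_rate * (u - s))\<^sup>2"
  proof (intro sum_measure_times_law_le V disj su)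
    fix D assume D: "D \<in> {D. D \<subseteq> S \<and> (i \<in> D \<and> j \<in> D)}"
    then have "card {i, j} \<le> card D"
      using V finite_sub by (intro card_mono) auto
    then show "2 \<le> card D" using ij by simp
  qed auto
  finally show ?thesis .
qed

text \<open>
  On the interval where \<open>j\<close> adopts alone, its density lies between the rate and the rate times
  \<open>exp (- max_rate * (u - s))\<close>, because the exponents of \<open>j\<close> and of the survival of the others add
  up to at most \<open>max_rate * (u - s)\<close>.
\<close>

lemma measure_times_law_eq_singleton:
  assumes V: "A \<subseteq> V" "S \<subseteq> V" and disj: "A \<inter> S = {}" and j: "j \<in> S" and su: "s \<le> u"
  shows "\<bar>measure (times_law A S s) {y \<in> space (times_law A S s). {j \<in> S. y j \<le> u} = {j}} - rate_given A j * (u - s)\<bar>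
      \<le> (max_rate * (u - s))\<^sup>2" (is "\<bar>?m - _\<bar> \<le> _")
proof -
  interpret prob_space "times_law A S s" by (rule prob_space_times_law[OF V disj])
  let ?f = "\<lambda>x. ennreal (time_density A {j} s x * survival A {j} (S - {j}) s u x) * of_bool (\<forall>b\<in>{j}. x b \<le> u)"
  let ?box = "\<lambda>x. indicator (PiE {j} (\<lambda>_. {s<..u})) x :: ennreal"
  have jV: "j \<in> V" and jA: "j \<notin> A" using V j disj by auto
  have pr: "0 < rate_given A j" "rate_given A j \<le> max_rate"
    using V jV by (auto intro: rate_given_pos order_trans[OF rate_given_le rate_le])
  have m: "ennreal ?m = integral\<^sup>N (PiM {j} (\<lambda>_. lborel)) ?f"
    using emeasure_times_law_eq_adopters[OF V disj _ su, of "{j}"] j by (simp add: emeasure_eq_measure)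
  have time_density: "time_density A {j} s x = of_bool (s < x j) * (rate_given A j * exp (- (rate_given A j * (x j - s))))" for x
    by (simp add: time_density_def hazard_def cum_hazard_def)
  have bounds: "ennreal (rate_given A j * exp (- (max_rate * (u - s)))) * ?box x \<le> ?f x \<and> ?f x \<le> ennreal (rate_given A j) * ?box x"
    if x: "x \<in> space (PiM {j} (\<lambda>_. lborel))" for x
  proof (cases "s < x j \<and> x j \<le> u")
    case True
    have box: "?box x = 1"
      using x True by (auto simp: space_PiM PiE_def indicator_def)
    have "(\<Sum>i\<in>S - {j}. rate_given A i * (u - s) + q j i * (u - x j)) \<le> (\<Sum>i\<in>S - {j}. (p i + (\<Sum>k\<in>V. q k i)) * (u - s))"
    proof (intro sum_mono)
      fix i assume i: "i \<in> S - {j}"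
      have "q j i * (u - x j) \<le> q j i * (u - s)"
        using i jV V True by (intro mult_left_mono q_nonneg) auto
      then have "rate_given A i * (u - s) + q j i * (u - x j) \<le> rate_given (insert j A) i * (u - s)"
        using rate_given_Un[of A "{j}" i] V jV jA by (simp add: algebra_simps)
      also have "\<dots> \<le> (p i + (\<Sum>k\<in>V. q k i)) * (u - s)"
        using i V j su by (intro mult_right_mono rate_given_le) auto
      finally show "rate_given A i * (u - s) + q j i * (u - x j) \<le> (p i + (\<Sum>k\<in>V. q k i)) * (u - s)" .
    qed
    moreover have "rate_given A j * (x j - s) \<le> (p j + (\<Sum>k\<in>V. q k j)) * (u - s)"
      using True V jV pr rate_given_le[of A j] by (intro mult_mono) auto
    moreover have "(p j + (\<Sum>k\<in>V. q k j)) * (u - s) + (\<Sum>i\<in>S - {j}. (p i + (\<Sum>k\<in>V. q k i)) * (u - s))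
        = (\<Sum>i\<in>S. p i + (\<Sum>k\<in>V. q k i)) * (u - s)"
      unfolding sum_distrib_right using V j finite_sub[OF V(2)] by (simp add: sum.remove)
    moreover have "(\<Sum>i\<in>S. p i + (\<Sum>k\<in>V. q k i)) * (u - s) \<le> max_rate * (u - s)"
      using su by (intro mult_right_mono rate_sum_le V) auto
    ultimately have expo: "rate_given A j * (x j - s) + (\<Sum>i\<in>S - {j}. rate_given A i * (u - s) + q j i * (u - x j)) \<le> max_rate * (u - s)"
      by linarith
    have eq: "time_density A {j} s x * survival A {j} (S - {j}) s u x
        = rate_given A j * exp (- (rate_given A j * (x j - s) + (\<Sum>i\<in>S - {j}. rate_given A i * (u - s) + q j i * (u - x j))))"
      using True by (simp add: time_density survival_def exp_add[symmetric] exp_diff exp_minus field_simps)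
    have "time_density A {j} s x * survival A {j} (S - {j}) s u x \<le> rate_given A j * 1"
      using True pr V j su by (intro mult_mono survival_le_1 survival_nonneg) (auto simp: time_density mult_le_cancel_left2)
    moreover have "rate_given A j * exp (- (max_rate * (u - s))) \<le> time_density A {j} s x * survival A {j} (S - {j}) s u x"
      unfolding eq using expo pr by (intro mult_left_mono) auto
    ultimately show ?thesis
      using box True by (auto intro: ennreal_leI)
  next
    case False
    then have "?box x = 0" "?f x = 0"
      by (auto simp: indicator_def time_density)
    then show ?thesis by simp
  qed
  have "ennreal ?m \<le> (\<integral>\<^sup>+x. ennreal (rate_given A j) * ?box x \<partial>PiM {j} (\<lambda>_. lborel))"
    unfolding m using bounds by (intro nn_integral_mono) auto
  also have "\<dots> = ennreal (rate_given A j * (u - s))"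
    using su pr nn_integral_box[of "{j}" s u "rate_given A j"] by (simp add: ennreal_mult[symmetric])
  finally have upper: "?m \<le> rate_given A j * (u - s)"
    using su pr by (subst (asm) ennreal_le_iff) auto
  have "ennreal (rate_given A j * exp (- (max_rate * (u - s))) * (u - s))
     = (\<integral>\<^sup>+x. ennreal (rate_given A j * exp (- (max_rate * (u - s)))) * ?box x \<partial>PiM {j} (\<lambda>_. lborel))"
    using su pr nn_integral_box[of "{j}" s u "rate_given A j * exp (- (max_rate * (u - s)))"] by (simp add: ennreal_mult[symmetric])
  also have "\<dots> \<le> ennreal ?m"
    unfolding m using bounds by (intro nn_integral_mono) auto
  finally have lower: "rate_given A j * exp (- (max_rate * (u - s))) * (u - s) \<le> ?m"
    by (subst (asm) ennreal_le_iff) auto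
  have "rate_given A j * (u - s) * (1 - max_rate * (u - s)) \<le> rate_given A j * (u - s) * exp (- (max_rate * (u - s)))"
    using pr su exp_ge_add_one_self[of "- (max_rate * (u - s))"] by (intro mult_left_mono) auto
  moreover have "rate_given A j * (u - s) * (max_rate * (u - s)) \<le> max_rate * (u - s) * (max_rate * (u - s))"
    using pr su max_rate_nonneg by (intro mult_right_mono) auto
  ultimately have "rate_given A j * (u - s) - (max_rate * (u - s))\<^sup>2 \<le> ?m"
    using lower by (simp add: power2_eq_square algebra_simps)
  with upper show ?thesis
    by (simp add: abs_le_iff)
qed

lemma measure_times_law_single:
  assumes V: "A \<subseteq> V" "S \<subseteq> V" and disj: "A \<inter> S = {}" and j: "j \<in> S" and su: "s \<le> u"
  shows "\<bar>measure (times_law A S s) {y \<in> space (times_law A S s). y j \<le> u} - rate_given A j * (u - s)\<bar>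
      \<le> (1 + 2 ^ card V) * (max_rate * (u - s))\<^sup>2"
proof -
  let ?m = "\<lambda>D. measure (times_law A S s) {y \<in> space (times_law A S s). {j \<in> S. y j \<le> u} = D}"
  let ?F = "{D. D \<subseteq> S \<and> j \<in> D}"
  have fin: "finite S" using V finite_sub by auto
  have finF: "finite ?F"
    using fin by (intro finite_subset[of ?F "Pow S"]) auto
  have "measure (times_law A S s) {y \<in> space (times_law A S s). y j \<le> u}
      = measure (times_law A S s) {y \<in> space (times_law A S s). j \<in> {j \<in> S. y j \<le> u}}"
    using j by simp
  also have "\<dots> = (\<Sum>D\<in>?F. ?m D)"
    by (rule measure_times_law_adopters[OF V disj])
  also have "\<dots> = ?m {j} + (\<Sum>D\<in>?F - {{j}}. ?m D)"
    using finF j by (subst sum.remove[of _ "{j}"]) auto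
  finally have eq: "measure (times_law A S s) {y \<in> space (times_law A S s). y j \<le> u} = ?m {j} + (\<Sum>D\<in>?F - {{j}}. ?m D)" .
  have "(\<Sum>D\<in>?F - {{j}}. ?m D) \<le> 2 ^ card V * (max_rate * (u - s))\<^sup>2"
  proof (intro sum_measure_times_law_le V disj su)
    fix D assume D: "D \<in> ?F - {{j}}"
    then obtain i where "i \<in> D" "i \<noteq> j" by auto
    then have "card {i, j} \<le> card D"
      using D fin finite_subset by (intro card_mono) auto
    then show "2 \<le> card D" using \<open>i \<noteq> j\<close> by simp
  qed auto
  moreover have "0 \<le> (\<Sum>D\<in>?F - {{j}}. ?m D)"
    by (intro sum_nonneg) simp
  moreover have "\<bar>?m {j} - rate_given A j * (u - s)\<bar> \<le> (max_rate * (u - s))\<^sup>2"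
    by (rule measure_times_law_eq_singleton[OF V disj j su])
  ultimately show ?thesis
    unfolding eq by (simp add: algebra_simps abs_le_iff)
qed

end

section \<open>The Markov property of the adoption times\<close>

text \<open>
  Any probability space with adoption times of the required joint law will do. Leaving the space
  open separates the Markov property from the choice of a sample space of trajectories.
\<close>

locale adoption_times = finite_rates V p q + prob_space P
  for V :: "'i set" and p :: "'i \<Rightarrow> real" and q :: "'i \<Rightarrow> 'i \<Rightarrow> real" and P :: "'w measure" +
  fixes T :: "'w \<Rightarrow> 'i \<Rightarrow> real"
  assumes measurable_T: "T \<in> P \<rightarrow>\<^sub>M PiM V (\<lambda>_. lborel)"
    and distr_T: "distr P (PiM V (\<lambda>_. lborel)) T = times_law {} V 0"
begin

definition adopters :: "real \<Rightarrow> 'w \<Rightarrow> 'i set" where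
  "adopters t \<omega> = {j \<in> V. T \<omega> j \<le> t}"

text \<open>
  The information on the adoption times that is available at time \<open>t\<close>: times after \<open>t\<close> are
  replaced by one value beyond \<open>t\<close>.
\<close>

definition censor :: "real \<Rightarrow> ('i \<Rightarrow> real) \<Rightarrow> 'i \<Rightarrow> real" where
  "censor t x = (\<lambda>j\<in>V. if x j \<le> t then x j else t + 1)"

definition past :: "real \<Rightarrow> 'w measure" where
  "past t = vimage_algebra (space P) (\<lambda>\<omega>. censor t (T \<omega>)) (PiM V (\<lambda>_. lborel))"

text \<open>
  The probability, for a process with adopters \<open>B\<close> at time \<open>t\<close>, that the set of adopters at time
  \<open>u\<close> satisfies \<open>Q\<close>.
\<close>

definition transition :: "'i set \<Rightarrow> real \<Rightarrow> real \<Rightarrow> ('i set \<Rightarrow> bool) \<Rightarrow> real" where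
  "transition B t u Q = measure (times_law B (V - B) t) {y \<in> space (times_law B (V - B) t). Q (B \<union> {j \<in> V - B. y j \<le> u})}"

lemma pred_T_le: "j \<in> V \<Longrightarrow> Measurable.pred P (\<lambda>\<omega>. T \<omega> j \<le> t)"
  using measurable_compose[OF measurable_T pred_coord_le] .

lemma pred_adopters: "Measurable.pred P (\<lambda>\<omega>. Q (adopters t \<omega>))"
  unfolding adopters_def by (intro pred_set_of_finite finite_V pred_T_le)

lemma measurable_censor: "censor t \<in> PiM V (\<lambda>_. lborel) \<rightarrow>\<^sub>M PiM V (\<lambda>_. lborel)"
  unfolding censor_def[abs_def]
proof (intro measurable_restrict)
  fix j assume "j \<in> V"
  then have s: "{x \<in> space (PiM V (\<lambda>_. lborel :: real measure)). x j \<le> t} \<in> sets (PiM V (\<lambda>_. lborel))"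
    and c: "(\<lambda>x. x j) \<in> PiM V (\<lambda>_. lborel :: real measure) \<rightarrow>\<^sub>M lborel"
    using pred_coord_le[of j V t] measurable_component_singleton[of j V "\<lambda>_. lborel :: real measure"]
    by (simp_all add: pred_def)
  have k: "(\<lambda>x. t + 1) \<in> PiM V (\<lambda>_. lborel :: real measure) \<rightarrow>\<^sub>M lborel"
    by simp
  show "(\<lambda>x. if x j \<le> t then x j else t + 1) \<in> PiM V (\<lambda>_. lborel :: real measure) \<rightarrow>\<^sub>M lborel"
    by (rule measurable_If[OF c k s])
qed

lemma measurable_censor_T: "(\<lambda>\<omega>. censor t (T \<omega>)) \<in> P \<rightarrow>\<^sub>M PiM V (\<lambda>_. lborel)"
  using measurable_compose[OF measurable_T measurable_censor] .

lemma sets_past: "sets (past t) = {{\<omega> \<in> space P. censor t (T \<omega>) \<in> E} | E. E \<in> sets (PiM V (\<lambda>_. lborel))}"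
proof -
  have "(\<lambda>\<omega>. censor t (T \<omega>)) \<in> space P \<rightarrow> space (PiM V (\<lambda>_. lborel))"
    using measurable_censor_T by (auto simp: measurable_def)
  then show ?thesis
    unfolding past_def by (subst sets_vimage_algebra2) (auto simp: vimage_def Int_def conj_commute)
qed

lemma emeasure_T:
  assumes "Measurable.pred (PiM V (\<lambda>_. lborel)) \<Phi>"
  shows "emeasure P {\<omega> \<in> space P. \<Phi> (T \<omega>)} = (\<integral>\<^sup>+x. ennreal (time_density {} V 0 x) * of_bool (\<Phi> x) \<partial>PiM V (\<lambda>_. lborel))"
proof -
  let ?E = "{x \<in> space (PiM V (\<lambda>_. lborel)). \<Phi> x}"
  have E: "?E \<in> sets (PiM V (\<lambda>_. lborel))"
    using assms by (simp add: pred_def)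
  have "{\<omega> \<in> space P. \<Phi> (T \<omega>)} = T -` ?E \<inter> space P"
    using measurable_space[OF measurable_T] by auto
  then have "emeasure P {\<omega> \<in> space P. \<Phi> (T \<omega>)} = emeasure (distr P (PiM V (\<lambda>_. lborel)) T) ?E"
    using emeasure_distr[OF measurable_T E] by simp
  also have "\<dots> = (\<integral>\<^sup>+x. ennreal (time_density {} V 0 x) * indicator ?E x \<partial>PiM V (\<lambda>_. lborel))"
    unfolding distr_T times_law_def by (intro emeasure_density borel_ennreal_time_density E)
  also have "\<dots> = (\<integral>\<^sup>+x. ennreal (time_density {} V 0 x) * of_bool (\<Phi> x) \<partial>PiM V (\<lambda>_. lborel))"
    by (intro nn_integral_cong) (simp add: indicator_def)
  finally show ?thesis .
qed

text \<open>
  Given the set \<open>B\<close> of adopters at time \<open>t\<close>, a past event is a condition on the times of \<open>B\<close> and the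
  adopters at time \<open>u\<close> are determined by the times of the others, so the integral splits.
\<close>

lemma emeasure_past_future:
  assumes t: "0 \<le> t" "t \<le> u" and E: "E \<in> sets (PiM V (\<lambda>_. lborel))" and B: "B \<subseteq> V"
  defines "F \<equiv> (\<integral>\<^sup>+x. ennreal (time_density {} B 0 x * survival {} B (V - B) 0 t x) * of_bool (\<forall>b\<in>B. x b \<le> t)
     * of_bool ((\<lambda>j\<in>V. if j \<in> B then x j else t + 1) \<in> E) \<partial>PiM B (\<lambda>_. lborel))"
  shows "emeasure P {\<omega> \<in> space P. censor t (T \<omega>) \<in> E \<and> adopters t \<omega> = B \<and> Q (adopters u \<omega>)} = F * ennreal (transition B t u Q)"
proof -
  let ?S = "V - B"
  let ?M = "\<lambda>S. PiM S (\<lambda>_. lborel :: real measure)"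
  have finS: "finite ?S" using finite_V by auto
  have V: "B \<union> ?S = V" using B by auto
  interpret L: prob_space "times_law B ?S t"
    using B by (intro prob_space_times_law) auto
  let ?\<Phi> = "\<lambda>x. censor t x \<in> E \<and> {j \<in> V. x j \<le> t} = B \<and> Q {j \<in> V. x j \<le> u}"
  let ?f = "\<lambda>x. of_bool ((\<lambda>j\<in>V. if j \<in> B then x j else t + 1) \<in> E) :: ennreal"
  let ?g = "\<lambda>y. of_bool (Q (B \<union> {j \<in> ?S. y j \<le> u})) :: ennreal"
  have "Measurable.pred (?M V) (\<lambda>x. censor t x \<in> E)"
    using measurable_censor E by measurable
  moreover have "Measurable.pred (?M V) (\<lambda>x. {j \<in> V. x j \<le> t} = B)" "Measurable.pred (?M V) (\<lambda>x. Q {j \<in> V. x j \<le> u})"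
    by (intro pred_set_of_finite[where Q = "\<lambda>D. D = B"] pred_set_of_finite[where Q = Q] finite_V pred_coord_le; assumption)+
  ultimately have m: "Measurable.pred (?M V) ?\<Phi>"
    by (intro pred_intros_logic)
  have mf: "?f \<in> borel_measurable (?M B)"
  proof -
    have "(\<lambda>x. \<lambda>j\<in>V. if j \<in> B then x j else t + 1) \<in> ?M B \<rightarrow>\<^sub>M ?M V"
    proof (intro measurable_restrict)
      show "(\<lambda>x. if j \<in> B then x j else t + 1) \<in> ?M B \<rightarrow>\<^sub>M lborel" for j
        using measurable_coord[of j B] by (cases "j \<in> B") auto
    qed
    then have "Measurable.pred (?M B) (\<lambda>x. (\<lambda>j\<in>V. if j \<in> B then x j else t + 1) \<in> E)"
      using E by measurable
    then show ?thesis by measurable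
  qed
  have pg: "Measurable.pred (?M ?S) (\<lambda>y. Q (B \<union> {j \<in> ?S. y j \<le> u}))"
    by (intro pred_set_of_finite[where Q = "\<lambda>D. Q (B \<union> D)"] finS pred_coord_le)
  then have mg: "?g \<in> borel_measurable (?M ?S)"
    by measurable
  have "emeasure P {\<omega> \<in> space P. censor t (T \<omega>) \<in> E \<and> adopters t \<omega> = B \<and> Q (adopters u \<omega>)}
      = (\<integral>\<^sup>+x. ennreal (time_density {} V 0 x) * of_bool (?\<Phi> x) \<partial>?M V)"
    unfolding adopters_def by (rule emeasure_T[OF m])
  also have "\<dots> = (\<integral>\<^sup>+x. ennreal (time_density {} (B \<union> ?S) 0 x) *
             (of_bool (\<forall>b\<in>B. x b \<le> t) * of_bool (\<forall>j\<in>?S. t < x j)) *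
             (?f (restrict x B) * ?g (restrict x ?S)) \<partial>?M (B \<union> ?S))"
  proof (unfold V, intro nn_integral_cong)
    fix x :: "'i \<Rightarrow> real"
    have iff: "{j \<in> V. x j \<le> t} = B \<longleftrightarrow> (\<forall>b\<in>B. x b \<le> t) \<and> (\<forall>j\<in>?S. t < x j)"
      unfolding set_eq_iff using B by (auto simp: not_le; meson DiffI linorder_not_le)
    show "ennreal (time_density {} V 0 x) * of_bool (?\<Phi> x) = ennreal (time_density {} V 0 x) *
             (of_bool (\<forall>b\<in>B. x b \<le> t) * of_bool (\<forall>j\<in>?S. t < x j)) *
             (?f (restrict x B) * ?g (restrict x ?S))"
    proof (cases "{j \<in> V. x j \<le> t} = B")
      case True
      have le: "x j \<le> t \<longleftrightarrow> j \<in> B" if "j \<in> V" for j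
        using True that by auto
      have "censor t x = (\<lambda>j\<in>V. if j \<in> B then restrict x B j else t + 1)"
        unfolding censor_def using le by (intro restrict_ext) auto
      moreover have "{j \<in> V. x j \<le> u} = B \<union> {j \<in> ?S. restrict x ?S j \<le> u}"
        using le t B by (auto intro: order_trans)
      ultimately show ?thesis
        using True iff by simp
    next
      case False
      then have "of_bool (\<forall>b\<in>B. x b \<le> t) * of_bool (\<forall>j\<in>?S. t < x j) = (0 :: ennreal)"
        unfolding iff by auto
      then show ?thesis
        using False by simp
    qed
  qed
  also have "\<dots> = F * (\<integral>\<^sup>+y. ennreal (time_density ({} \<union> B) ?S t y) * ?g y \<partial>?M ?S)"
    unfolding F_def using B by (intro nn_integral_split t mf mg) auto
  also have "(\<integral>\<^sup>+y. ennreal (time_density ({} \<union> B) ?S t y) * ?g y \<partial>?M ?S)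
      = (\<integral>\<^sup>+y. ennreal (time_density B ?S t y) * indicator {y \<in> space (?M ?S). Q (B \<union> {j \<in> ?S. y j \<le> u})} y \<partial>?M ?S)"
    by (intro nn_integral_cong) (simp add: indicator_def)
  also have "\<dots> = emeasure (times_law B ?S t) {y \<in> space (?M ?S). Q (B \<union> {j \<in> ?S. y j \<le> u})}"
    unfolding times_law_def using pg by (intro emeasure_density[symmetric] borel_ennreal_time_density) (simp add: pred_def)
  also have "\<dots> = ennreal (transition B t u Q)"
    by (simp add: transition_def L.emeasure_eq_measure)
  finally show ?thesis .
qed

lemma transition_True: "B \<subseteq> V \<Longrightarrow> transition B t u (\<lambda>_. True) = 1"
proof -
  assume "B \<subseteq> V"
  then interpret L: prob_space "times_law B (V - B) t"
    by (intro prob_space_times_law) auto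
  show ?thesis
    using L.prob_space by (simp add: transition_def)
qed

text \<open>
  Taking \<open>Q\<close> to be always true identifies the first factor as the probability of the past event.
\<close>

lemma prob_past_future:
  assumes t: "0 \<le> t" "t \<le> u" and E: "E \<in> sets (PiM V (\<lambda>_. lborel))" and B: "B \<subseteq> V"
  shows "prob {\<omega> \<in> space P. censor t (T \<omega>) \<in> E \<and> adopters t \<omega> = B \<and> Q (adopters u \<omega>)}
     = prob {\<omega> \<in> space P. censor t (T \<omega>) \<in> E \<and> adopters t \<omega> = B} * transition B t u Q"
proof -
  have "emeasure P {\<omega> \<in> space P. censor t (T \<omega>) \<in> E \<and> adopters t \<omega> = B \<and> Q (adopters u \<omega>)}
     = emeasure P {\<omega> \<in> space P. censor t (T \<omega>) \<in> E \<and> adopters t \<omega> = B} * ennreal (transition B t u Q)"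
    using emeasure_past_future[OF t E B, of Q] emeasure_past_future[OF t E B, of "\<lambda>_. True"] transition_True[OF B]
    by simp
  then show ?thesis
    unfolding emeasure_eq_measure by (simp add: ennreal_mult[symmetric] transition_def)
qed

lemma adopters_subset: "adopters t \<omega> \<subseteq> V"
  by (auto simp: adopters_def)

text \<open>
  The conditional probability is the same function of the current adopters for every information
  \<open>F\<close> between the state and the whole past. Comparing the two extremes is the Markov property.
\<close>

theorem cond_prob_adopters:
  assumes t: "0 \<le> t" "t \<le> u" and F: "space F = space P" "sets F \<subseteq> sets (past t)"
    and state: "\<And>B. {\<omega> \<in> space P. adopters t \<omega> = B} \<in> sets F"
  shows "AE \<omega> in P. real_cond_exp P F (indicator {\<omega> \<in> space P. Q (adopters u \<omega>)}) \<omega>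
       = transition (adopters t \<omega>) t u Q"
proof -
  have "sets (past t) \<subseteq> events"
  proof
    fix A assume "A \<in> sets (past t)"
    then obtain E where "A = {\<omega> \<in> space P. censor t (T \<omega>) \<in> E}" "E \<in> sets (PiM V (\<lambda>_. lborel))"
      unfolding sets_past by auto
    then show "A \<in> events"
      using measurable_sets[OF measurable_censor_T[of t], of E] by (simp add: vimage_def Int_def conj_commute)
  qed
  with F have sub: "subalgebra P F"
    by (auto simp: subalgebra_def)
  interpret finite_measure_subalgebra P F
    by unfold_locales (rule sub)
  let ?E = "{\<omega> \<in> space P. Q (adopters u \<omega>)}"
  let ?K = "\<lambda>\<omega>. transition (adopters t \<omega>) t u Q"
  have finPow: "finite (Pow V)" using finite_V by simp
  have E: "?E \<in> events"
    using pred_adopters by (simp add: pred_def)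
  have ev: "{\<omega> \<in> space P. adopters t \<omega> = B} \<in> events" for B
    using pred_adopters[of "\<lambda>D. D = B"] by (simp add: pred_def)
  have K_eq: "?K \<omega> = (\<Sum>B\<in>Pow V. transition B t u Q * indicator {\<omega> \<in> space P. adopters t \<omega> = B} \<omega>)"
    if "\<omega> \<in> space P" for \<omega>
  proof -
    have "(\<Sum>B\<in>Pow V. transition B t u Q * indicator {\<omega> \<in> space P. adopters t \<omega> = B} \<omega>)
      = (\<Sum>B\<in>Pow V. if B = adopters t \<omega> then transition B t u Q else 0)"
      using that by (intro sum.cong) (auto simp: indicator_def)
    then show ?thesis
      using adopters_subset[of t \<omega>] finPow by simp
  qed
  have int_B: "integrable P (\<lambda>\<omega>. transition B t u Q * indicator {\<omega> \<in> space P. adopters t \<omega> = B} \<omega>)" for B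
    using ev by (intro integrable_mult_right integrable_real_indicator) (auto simp: emeasure_eq_measure)
  show ?thesis
  proof (rule real_cond_exp_charact)
    show "integrable P (indicator ?E :: _ \<Rightarrow> real)"
      using E by (intro integrable_real_indicator) (auto simp: emeasure_eq_measure)
    show "integrable P ?K"
      using int_B by (subst Bochner_Integration.integrable_cong[OF refl K_eq]) auto
    show "?K \<in> borel_measurable F"
      using state F(1) by (subst measurable_cong[OF K_eq])
        (auto intro!: borel_measurable_sum borel_measurable_times borel_measurable_indicator)
    fix A assume A: "A \<in> sets F"
    then obtain H where H: "A = {\<omega> \<in> space P. censor t (T \<omega>) \<in> H}" "H \<in> sets (PiM V (\<lambda>_. lborel))"
      using F(2) unfolding sets_past by auto
    have A': "A \<in> events"
      using A sub by (auto simp: subalgebra_def)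
    have "(\<integral>\<omega>\<in>A. indicator ?E \<omega> \<partial>P) = (\<integral>\<omega>. indicator (A \<inter> ?E) \<omega> \<partial>P)"
      unfolding set_lebesgue_integral_def
      by (intro Bochner_Integration.integral_cong) (auto simp: indicator_def)
    also have "\<dots> = prob (A \<inter> ?E)"
      using A' E by (simp add: Int_absorb2 sets.sets_into_space)
    also have "A \<inter> ?E = (\<Union>B\<in>Pow V. {\<omega> \<in> space P. censor t (T \<omega>) \<in> H \<and> adopters t \<omega> = B \<and> Q (adopters u \<omega>)})"
      using H adopters_subset by auto
    also have "prob \<dots> = (\<Sum>B\<in>Pow V. prob {\<omega> \<in> space P. censor t (T \<omega>) \<in> H \<and> adopters t \<omega> = B \<and> Q (adopters u \<omega>)})"
    proof (rule finite_measure_finite_Union[OF finPow])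
      have "{\<omega> \<in> space P. censor t (T \<omega>) \<in> H \<and> adopters t \<omega> = B \<and> Q (adopters u \<omega>)}
         = A \<inter> {\<omega> \<in> space P. adopters t \<omega> = B} \<inter> ?E" for B
        using H by auto
      then show "(\<lambda>B. {\<omega> \<in> space P. censor t (T \<omega>) \<in> H \<and> adopters t \<omega> = B \<and> Q (adopters u \<omega>)}) ` Pow V \<subseteq> events"
        using A' E ev by auto
    qed (auto simp: disjoint_family_on_def)
    also have "\<dots> = (\<Sum>B\<in>Pow V. prob {\<omega> \<in> space P. censor t (T \<omega>) \<in> H \<and> adopters t \<omega> = B} * transition B t u Q)"
      by (intro sum.cong prob_past_future t H) auto
    also have "\<dots> = (\<Sum>B\<in>Pow V. \<integral>\<omega>. indicator A \<omega> * (transition B t u Q * indicator {\<omega> \<in> space P. adopters t \<omega> = B} \<omega>) \<partial>P)"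
    proof (intro sum.cong refl)
      fix B
      have "(\<integral>\<omega>. indicator A \<omega> * (transition B t u Q * indicator {\<omega> \<in> space P. adopters t \<omega> = B} \<omega>) \<partial>P)
         = (\<integral>\<omega>. transition B t u Q * indicator {\<omega> \<in> space P. censor t (T \<omega>) \<in> H \<and> adopters t \<omega> = B} \<omega> \<partial>P)"
        using H by (intro Bochner_Integration.integral_cong) (auto simp: indicator_def)
      also have "\<dots> = transition B t u Q * prob ({\<omega> \<in> space P. censor t (T \<omega>) \<in> H \<and> adopters t \<omega> = B} \<inter> space P)"
        by (simp add: Bochner_Integration.integral_indicator)
      also have "{\<omega> \<in> space P. censor t (T \<omega>) \<in> H \<and> adopters t \<omega> = B} \<inter> space P = {\<omega> \<in> space P. censor t (T \<omega>) \<in> H \<and> adopters t \<omega> = B}"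
        by auto
      finally show "prob {\<omega> \<in> space P. censor t (T \<omega>) \<in> H \<and> adopters t \<omega> = B} * transition B t u Q
         = (\<integral>\<omega>. indicator A \<omega> * (transition B t u Q * indicator {\<omega> \<in> space P. adopters t \<omega> = B} \<omega>) \<partial>P)"
        by simp
    qed
    also have "\<dots> = (\<integral>\<omega>. (\<Sum>B\<in>Pow V. indicator A \<omega> * (transition B t u Q * indicator {\<omega> \<in> space P. adopters t \<omega> = B} \<omega>)) \<partial>P)"
      by (rule Bochner_Integration.integral_sum[symmetric])
        (rule integrable_mult_indicator[OF A' int_B, unfolded real_scaleR_def])
    also have "\<dots> = (\<integral>\<omega>\<in>A. ?K \<omega> \<partial>P)"
      unfolding set_lebesgue_integral_def
      by (intro Bochner_Integration.integral_cong) (simp_all add: K_eq sum_distrib_left)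
    finally show "(\<integral>\<omega>\<in>A. indicator ?E \<omega> \<partial>P) = (\<integral>\<omega>\<in>A. ?K \<omega> \<partial>P)" .
  qed
qed

end

section \<open>Every finite network carries a Bass process\<close>

text \<open>
  Positivity of the times holds almost surely by the density; it is required everywhere because a
  Bass process has no adopters at time \<open>0\<close> on the whole sample space.
\<close>

locale network_adoption_times = adoption_times "nodes N" "ext_rate N" "int_rate N" P T
  for N :: network and P :: "'w measure" and T :: "'w \<Rightarrow> nat \<Rightarrow> real" +
  assumes network: "bass_network N"
    and T_pos: "\<omega> \<in> space P \<Longrightarrow> j \<in> nodes N \<Longrightarrow> 0 < T \<omega> j"
begin

definition X :: "nat \<Rightarrow> real \<Rightarrow> 'w \<Rightarrow> bool" where
  "X j t \<omega> = (T \<omega> j \<le> t)"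

lemma adopters_eq: "adopters t \<omega> = {j \<in> nodes N. X j t \<omega>}"
  by (simp add: adopters_def X_def)

lemma history_le_past:
  shows "sets (history_algebra N P X t) \<subseteq> sets (past t)"
proof -
  have space: "space (past t) = space P"
    by (simp add: past_def)
  have "sigma_sets (space (past t)) {{\<omega> \<in> space P. X j s \<omega>} | j s. j \<in> nodes N \<and> 0 \<le> s \<and> s \<le> t} \<subseteq> sets (past t)"
  proof (rule sets.sigma_sets_subset, safe)
    fix j s assume j: "j \<in> nodes N" "0 \<le> s" "s \<le> t"
    let ?E = "{x \<in> space (PiM (nodes N) (\<lambda>_. lborel :: real measure)). x j \<le> s}"
    have "X j s \<omega> \<longleftrightarrow> censor t (T \<omega>) \<in> ?E" if "\<omega> \<in> space P" for \<omega>
      using j that measurable_space[OF measurable_censor_T that, of t] by (auto simp: X_def censor_def)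
    then have eq: "{\<omega> \<in> space P. X j s \<omega>} = {\<omega> \<in> space P. censor t (T \<omega>) \<in> ?E}"
      by blast
    have "?E \<in> sets (PiM (nodes N) (\<lambda>_. lborel))"
      by (rule pred_coord_le[OF j(1), of s, unfolded pred_def])
    then show "{\<omega> \<in> space P. X j s \<omega>} \<in> sets (past t)"
      unfolding sets_past by (intro CollectI exI[of _ ?E] conjI eq)
  qed
  then show ?thesis
    by (simp add: sets_history_algebra space)
qed

lemma adopters_state: "{\<omega> \<in> space P. adopters t \<omega> = B} \<in> sets (state_algebra N P X t)"
proof -
  have "Measurable.pred (state_algebra N P X t) (\<lambda>\<omega>. {j \<in> nodes N. X j t \<omega>} = B)"
    using pred_set_of_finite[where Q = "\<lambda>D. D = B", OF finite_V pred_state_algebra] .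
  then show ?thesis
    by (simp add: pred_def space_state_algebra adopters_eq)
qed

lemma state_algebra_adopters:
  assumes "A \<in> sets (state_algebra N P X u)"
  obtains Q where "A = {\<omega> \<in> space P. Q (adopters u \<omega>)}"
proof -
  let ?M = "vimage_algebra (space P) (adopters u) (count_space UNIV)"
  have "sigma_sets (space ?M) {{\<omega> \<in> space P. X j u \<omega>} | j. j \<in> nodes N} \<subseteq> sets ?M"
  proof (rule sets.sigma_sets_subset, safe)
    fix j assume "j \<in> nodes N"
    then have eq: "{\<omega> \<in> space P. X j u \<omega>} = adopters u -` {D. j \<in> D} \<inter> space P"
      by (auto simp: adopters_eq)
    show "{\<omega> \<in> space P. X j u \<omega>} \<in> sets ?M"
      unfolding eq by (rule in_vimage_algebra) simp
  qed
  then have "A \<in> sets ?M"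
    using assms by (auto simp: sets_state_algebra)
  then obtain C where "A = adopters u -` C \<inter> space P"
    by (auto simp: sets_vimage_algebra2)
  then show thesis
    using that[of "\<lambda>D. D \<in> C"] by (auto simp: vimage_def Int_def conj_commute)
qed

lemma cond_prob_state:
  assumes t: "0 \<le> t" "t \<le> u"
  shows "AE \<omega> in P. cond_prob_given P (state_algebra N P X t) {\<omega> \<in> space P. Q (adopters u \<omega>)} \<omega>
     = transition (adopters t \<omega>) t u Q"
  using order_trans[OF state_le_history[OF t(1)] history_le_past]
  by (intro cond_prob_adopters t adopters_state) (auto simp: space_state_algebra)

lemma cond_prob_history:
  assumes t: "0 \<le> t" "t \<le> u"
  shows "AE \<omega> in P. cond_prob_given P (history_algebra N P X t) {\<omega> \<in> space P. Q (adopters u \<omega>)} \<omega>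
     = transition (adopters t \<omega>) t u Q"
  using adopters_state state_le_history[OF t(1), of N P X] history_le_past
  by (intro cond_prob_adopters t) (auto simp: space_history_algebra)

lemma adoption_rate_eq:
  "adoption_rate N X j t \<omega> = rate_given (adopters t \<omega>) j"
proof -
  have "(\<Sum>\<^sub>\<infinity>k\<in>nodes N. int_rate N k j * of_bool (X k t \<omega>)) = (\<Sum>k\<in>nodes N. int_rate N k j * of_bool (X k t \<omega>))"
    using finite_V by simp
  also have "\<dots> = (\<Sum>k\<in>adopters t \<omega>. int_rate N k j)"
    unfolding adopters_eq using finite_V by (intro sum.mono_neutral_cong_right) auto
  finally show ?thesis
    by (simp add: adoption_rate_def rate_given_def)
qed

sublocale process: bass_process P N X
proof
  show "bass_network N" by (rule network)
  show "X j t \<in> P \<rightarrow>\<^sub>M count_space UNIV" if "j \<in> nodes N" for j t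
    unfolding X_def[abs_def] using pred_T_le[OF that] .
  show "\<not> X j 0 \<omega>" if "j \<in> nodes N" "\<omega> \<in> space P" for j \<omega>
    using T_pos[OF that(2,1)] by (simp add: X_def)
  show "X j t \<omega>" if "s \<le> t" "X j s \<omega>" for j s t \<omega>
    using that by (simp add: X_def)
  show "AE \<omega> in P. cond_prob_given P (history_algebra N P X t) A \<omega> = cond_prob_given P (state_algebra N P X t) A \<omega>"
    if t: "0 \<le> t" "t \<le> u" and A: "A \<in> sets (state_algebra N P X u)" for t u A
  proof -
    obtain Q where A: "A = {\<omega> \<in> space P. Q (adopters u \<omega>)}"
      using state_algebra_adopters[OF A] by blast
    show ?thesis
      using cond_prob_history[OF t, of Q] cond_prob_state[OF t, of Q] unfolding A
      by eventually_elim simp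
  qed
  fix j assume j: "j \<in> nodes N"
  have tendsto: "((\<lambda>h. C * h) \<longlongrightarrow> 0) (at_right 0)" for C :: real
    by (auto intro!: tendsto_eq_intros)
  let ?C = "(1 + 2 ^ card (nodes N)) * max_rate\<^sup>2"
  show "\<exists>\<epsilon>. (\<epsilon> \<longlongrightarrow> 0) (at_right 0) \<and>
           (\<forall>t\<ge>0. \<forall>h>0. AE \<omega> in P.
              let c = cond_prob_given P (state_algebra N P X t) {\<omega> \<in> space P. X j (t + h) \<omega>} \<omega>
              in if X j t \<omega> then c = 1
                 else \<bar>c - adoption_rate N X j t \<omega> * h\<bar> \<le> \<epsilon> h * h)"
  proof (intro exI[of _ "\<lambda>h. ?C * h"] conjI tendsto allI impI)
    fix t h :: real assume t: "0 \<le> t" and h: "0 < h"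
    have eq: "{\<omega> \<in> space P. X j (t + h) \<omega>} = {\<omega> \<in> space P. j \<in> adopters (t + h) \<omega>}"
      using j by (auto simp: adopters_eq)
    have "AE \<omega> in P. cond_prob_given P (state_algebra N P X t) {\<omega> \<in> space P. X j (t + h) \<omega>} \<omega>
        = transition (adopters t \<omega>) t (t + h) (\<lambda>D. j \<in> D)"
      unfolding eq using t h by (intro cond_prob_state) auto
    then show "AE \<omega> in P.
              let c = cond_prob_given P (state_algebra N P X t) {\<omega> \<in> space P. X j (t + h) \<omega>} \<omega>
              in if X j t \<omega> then c = 1
                 else \<bar>c - adoption_rate N X j t \<omega> * h\<bar> \<le> ?C * h * h"
    proof eventually_elim
      case (elim \<omega>)
      let ?B = "adopters t \<omega>"
      let ?S = "nodes N - ?B"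
      have B: "?B \<subseteq> nodes N" by (rule adopters_subset)
      show ?case
      proof (cases "X j t \<omega>")
        case True
        then have "j \<in> ?B" using j by (simp add: adopters_eq)
        then have "transition ?B t (t + h) (\<lambda>D. j \<in> D) = 1"
          using transition_True[OF B, of t "t + h"] by (simp add: transition_def)
        then show ?thesis using elim True by simp
      next
        case False
        then have jS: "j \<in> ?S" using j by (simp add: adopters_eq)
        then have "transition ?B t (t + h) (\<lambda>D. j \<in> D) = measure (times_law ?B ?S t) {y \<in> space (times_law ?B ?S t). y j \<le> t + h}"
          by (simp add: transition_def)
        then have "\<bar>transition ?B t (t + h) (\<lambda>D. j \<in> D) - rate_given ?B j * h\<bar> \<le> (1 + 2 ^ card (nodes N)) * (max_rate * h)\<^sup>2"
          using measure_times_law_single[OF B _ _ jS, of t "t + h"] h by auto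
        then show ?thesis
          using elim False by (simp add: adoption_rate_eq power2_eq_square mult_ac)
      qed
    qed
  qed
  fix i assume i: "i \<in> nodes N" and ij: "i \<noteq> j"
  let ?D = "2 ^ card (nodes N) * max_rate\<^sup>2"
  show "\<exists>\<epsilon>. (\<epsilon> \<longlongrightarrow> 0) (at_right 0) \<and>
           (\<forall>t\<ge>0. \<forall>h>0. AE \<omega> in P.
              \<not> X i t \<omega> \<and> \<not> X j t \<omega> \<longrightarrow>
              cond_prob_given P (state_algebra N P X t)
                {\<omega> \<in> space P. X i (t + h) \<omega> \<and> X j (t + h) \<omega>} \<omega> \<le> \<epsilon> h * h)"
  proof (intro exI[of _ "\<lambda>h. ?D * h"] conjI tendsto allI impI)
    fix t h :: real assume t: "0 \<le> t" and h: "0 < h"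
    have eq: "{\<omega> \<in> space P. X i (t + h) \<omega> \<and> X j (t + h) \<omega>}
        = {\<omega> \<in> space P. i \<in> adopters (t + h) \<omega> \<and> j \<in> adopters (t + h) \<omega>}"
      using i j by (auto simp: adopters_eq)
    have "AE \<omega> in P. cond_prob_given P (state_algebra N P X t) {\<omega> \<in> space P. X i (t + h) \<omega> \<and> X j (t + h) \<omega>} \<omega>
        = transition (adopters t \<omega>) t (t + h) (\<lambda>D. i \<in> D \<and> j \<in> D)"
      unfolding eq using t h cond_prob_state[of t "t + h" "\<lambda>D. i \<in> D \<and> j \<in> D"] by auto
    then show "AE \<omega> in P. \<not> X i t \<omega> \<and> \<not> X j t \<omega> \<longrightarrow>
        cond_prob_given P (state_algebra N P X t) {\<omega> \<in> space P. X i (t + h) \<omega> \<and> X j (t + h) \<omega>} \<omega> \<le> ?D * h * h"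
    proof eventually_elim
      case (elim \<omega>)
      let ?B = "adopters t \<omega>"
      let ?S = "nodes N - ?B"
      have B: "?B \<subseteq> nodes N" by (rule adopters_subset)
      show ?case
      proof
        assume "\<not> X i t \<omega> \<and> \<not> X j t \<omega>"
        then have S: "i \<in> ?S" "j \<in> ?S" using i j by (simp_all add: adopters_eq)
        then have "transition ?B t (t + h) (\<lambda>D. i \<in> D \<and> j \<in> D)
            = measure (times_law ?B ?S t) {y \<in> space (times_law ?B ?S t). y i \<le> t + h \<and> y j \<le> t + h}"
          by (simp add: transition_def)
        also have "\<dots> \<le> 2 ^ card (nodes N) * (max_rate * h)\<^sup>2"
          using measure_times_law_joint_le[OF B _ _ S ij, of t "t + h"] h by auto
        finally show "cond_prob_given P (state_algebra N P X t) {\<omega> \<in> space P. X i (t + h) \<omega> \<and> X j (t + h) \<omega>} \<omega> \<le> ?D * h * h"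
          using elim by (simp add: power2_eq_square mult_ac)
      qed
    qed
  qed
qed

end

text \<open>
  The law of the adoption times is moved to the type of trajectories along the injection that maps
  times to the trajectory they generate.
\<close>

theorem finite_network_has_process:
  assumes N: "bass_network N" and fin: "finite (nodes N)"
  shows "\<exists>(P :: trajectory measure) X. bass_process P N X"
proof -
  interpret finite_rates "nodes N" "ext_rate N" "int_rate N"
    using N fin by unfold_locales (auto simp: bass_network_def)
  let ?V = "nodes N"
  let ?M = "PiM ?V (\<lambda>_. lborel :: real measure)"
  let ?L = "times_law {} ?V 0"
  interpret L: prob_space ?L
    by (rule prob_space_times_law) auto
  define \<phi> :: "(nat \<Rightarrow> real) \<Rightarrow> trajectory" where "\<phi> x = (\<lambda>s j. x j \<le> s)" for x
  have inj: "inj \<phi>"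
  proof (rule injI, rule ext)
    fix x y :: "nat \<Rightarrow> real" and j
    assume "\<phi> x = \<phi> y"
    then have "(x j \<le> s) = (y j \<le> s)" for s
      by (simp add: \<phi>_def fun_eq_iff)
    from this[of "x j"] this[of "y j"] show "x j = y j" by simp
  qed
  define P where "P = embed_measure ?L \<phi>"
  \<comment> \<open>On the null set where some time is not positive, all times are redefined as \<open>1\<close>.\<close>
  define T where "T \<omega> = (if \<forall>j\<in>?V. 0 < inv \<phi> \<omega> j then inv \<phi> \<omega> else (\<lambda>j\<in>?V. 1))" for \<omega>
  have m\<phi>: "\<phi> \<in> ?L \<rightarrow>\<^sub>M P"
    unfolding P_def using inj by (rule measurable_embed_measure2)
  have P_distr: "P = distr ?L P \<phi>"
    unfolding P_def by (rule embed_measure_eq_distr[OF inj])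
  interpret P: prob_space P
    by (subst P_distr) (rule L.prob_space_distr[OF m\<phi>])
  define r where "r x = (if \<forall>j\<in>?V. 0 < x j then x else (\<lambda>j\<in>?V. 1 :: real))" for x
  have T\<phi>: "T (\<phi> x) = r x" for x
    using inj by (simp add: T_def r_def)
  have mr: "r \<in> ?M \<rightarrow>\<^sub>M ?M"
    unfolding r_def[abs_def]
  proof (intro measurable_If measurable_ident)
    have "Measurable.pred ?M (\<lambda>x. \<forall>j\<in>?V. \<not> x j \<le> 0)"
      using fin by (intro pred_intros_finite pred_intros_logic pred_coord_le) auto
    then show "{x \<in> space ?M. \<forall>j\<in>?V. 0 < x j} \<in> sets ?M"
      by (simp add: pred_def not_le)
  qed (auto intro!: measurable_const simp: space_PiM)
  have mT: "T \<in> P \<rightarrow>\<^sub>M ?M"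
    unfolding P_def by (intro measurable_embed_measure1) (simp add: T\<phi> mr cong: measurable_cong_sets)
  have "AE x in ?M. 0 < time_density {} ?V 0 x \<longrightarrow> r x = x"
    using time_density_eq_0[OF fin, where A = "{}" and s = 0] by (auto simp: r_def not_le[symmetric])
  then have AE_r: "AE x in ?L. r x = x"
    unfolding times_law_def by (subst AE_density[OF borel_ennreal_time_density]) simp
  have "distr P ?M T = distr (distr ?L P \<phi>) ?M T"
    by (rule arg_cong[where f = "\<lambda>P. distr P ?M T", OF P_distr])
  also have "\<dots> = distr ?L ?M (\<lambda>x. T (\<phi> x))"
    by (simp add: distr_distr[OF mT m\<phi>] comp_def)
  also have "\<dots> = distr ?L ?M (\<lambda>x. x)"
    using AE_r by (intro distr_cong_AE) (simp_all add: T\<phi> mr cong: measurable_cong_sets)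
  also have "\<dots> = ?L"
    by (intro distr_id2) simp
  finally have distr: "distr P ?M T = ?L" .
  interpret network_adoption_times N P T
    using N mT distr by unfold_locales (auto simp: T_def)
  show ?thesis
    using process.bass_process_axioms by blast
qed

section \<open>Complete networks approach the Bass formula\<close>

definition complete_network :: "real \<Rightarrow> real \<Rightarrow> nat \<Rightarrow> network" where
  "complete_network p q M =
     \<lparr>num_nodes = enat M, ext_rate = (\<lambda>_. p), int_rate = (\<lambda>k j. if k = j then 0 else q / (real M - 1))\<rparr>"

lemma nodes_complete_network: "nodes (complete_network p q M) = {1..M}"
  by (auto simp: nodes_def complete_network_def)

lemma total_int_rate_complete_network:
  assumes "2 \<le> M" "j \<in> {1..M}"
  shows "total_int_rate (complete_network p q M) j = q"
proof -
  have "total_int_rate (complete_network p q M) j = (\<Sum>k\<in>{1..M}. if k = j then 0 else q / (real M - 1))"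
    by (simp add: total_int_rate_def nodes_complete_network) (simp add: complete_network_def)
  also have "\<dots> = (\<Sum>k\<in>{1..M} - {j}. q / (real M - 1))"
    by (intro sum.mono_neutral_cong_right) auto
  also have "\<dots> = q"
    using assms by (simp add: card_Diff_singleton of_nat_diff)
  finally show ?thesis .
qed

lemma bass_network_complete:
  assumes "0 < p" "0 < q" "2 \<le> M"
  shows "bass_network (complete_network p q M)"
  using assms total_int_rate_complete_network[of M _ p q]
  unfolding bass_network_def nodes_complete_network
  by (auto simp: complete_network_def one_enat_def)

lemma uniform_bass_modelsD:
  assumes "0 < p" "0 < q" "(N, P, X) \<in> uniform_bass_models p q"
  shows "uniform_bass_process P N X p q"
  using assms unfolding uniform_bass_models_def
  by (auto intro!: uniform_bass_process.intro uniform_bass_process_axioms.intro)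

text \<open>
  The number \<open>i\<close> of contraction steps is chosen first, then the size \<open>M\<close> of the complete network, so
  that the two errors of \<open>nonadoption_le_power\<close> are at most \<open>e / 2\<close> each.
\<close>

lemma f_Bass_approximated:
  assumes p: "0 < p" and q: "0 < q" and t: "0 \<le> t" and e: "0 < e"
  obtains M P X where "2 \<le> M" "(complete_network p q M, P, X) \<in> uniform_bass_models p q"
    "\<And>j. j \<in> {1..M} \<Longrightarrow> f_Bass t p q - e \<le> adoption_prob P X j t"
proof -
  let ?r = "q / (p + q)"
  have "(\<lambda>i. ?r ^ i) \<longlonglongrightarrow> 0"
    using p q by (intro LIMSEQ_realpow_zero) auto
  from order_tendstoD(2)[OF this, of "e / 2"] e obtain i where i: "?r ^ i < e / 2"
    by (auto dest: eventually_happens)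
  define C where "C = real (i * (1 + i)) * q / (p + q)"
  have C: "0 \<le> C" using p q by (simp add: C_def)
  obtain m :: nat where m: "C / (e / 2) < m"
    using reals_Archimedean2 by blast
  \<comment> \<open>With \<open>M - 1 = m + 1\<close> the accumulated error is \<open>C / (m + 1)\<close>, and \<open>M \<ge> 2\<close> gives every node a
    neighbour.\<close>
  define M where "M = m + 2"
  define \<kappa> where "\<kappa> = q / (real M - 1)"
  let ?N = "complete_network p q M"
  have M: "2 \<le> M" by (simp add: M_def)
  have N: "bass_network ?N"
    by (rule bass_network_complete[OF p q M])
  have fin: "finite (nodes ?N)"
    by (simp add: nodes_complete_network)
  obtain P :: "trajectory measure" and X where PX: "bass_process P ?N X"
    using finite_network_has_process[OF N fin] by blast
  have mem: "(?N, P, X) \<in> uniform_bass_models p q"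
    using PX total_int_rate_complete_network[OF M]
    by (simp add: uniform_bass_models_def nodes_complete_network) (simp add: complete_network_def)
  interpret uniform_bass_process P ?N X p q
    by (rule uniform_bass_modelsD[OF p q mem])
  have \<kappa>: "0 \<le> \<kappa>" using q by (simp add: \<kappa>_def M_def)
  have small: "i * (1 + i) * \<kappa> / (p + q) \<le> e / 2"
  proof -
    have "i * (1 + i) * \<kappa> / (p + q) = C / (m + 1)"
      by (simp add: C_def \<kappa>_def M_def)
    also have "\<dots> \<le> e / 2"
      using m e C by (simp add: field_simps)
    finally show ?thesis .
  qed
  have "f_Bass t p q - e \<le> adoption_prob P X j t" if j: "j \<in> {1..M}" for j
  proof -
    have jN: "j \<in> nodes ?N" using j by (simp add: nodes_complete_network)
    have "nonadoption {j} t \<le> y t ^ card {j} + ?r ^ i + i * (card {j} + i) * \<kappa> / (p + q)"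
      using \<kappa> q jN t M by (intro nonadoption_le_power fin) (auto simp: complete_network_def \<kappa>_def)
    then have "nonadoption {j} t \<le> y t + ?r ^ i + i * (1 + i) * \<kappa> / (p + q)"
      by simp
    then show ?thesis
      using small i adoption_prob_eq[OF jN t] unfolding bass_nonadoption_def by linarith
  qed
  with M mem show thesis by (rule that)
qed

lemma avg_adoption_le:
  assumes "\<And>j. j \<in> {1..n} \<Longrightarrow> adoption_prob P X j t \<le> c" "0 \<le> c"
  shows "avg_adoption P X n t \<le> c"
proof (cases "n = 0")
  case False
  have "(\<Sum>j=1..n. adoption_prob P X j t) \<le> (\<Sum>j=1..n. c)"
    using assms by (intro sum_mono) auto
  then show ?thesis
    using False by (simp add: avg_adoption_def divide_le_eq mult.commute)
qed (use assms in \<open>simp add: avg_adoption_def\<close>)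

lemma avg_adoption_ge:
  assumes "\<And>j. j \<in> {1..n} \<Longrightarrow> c \<le> adoption_prob P X j t" "0 < n"
  shows "c \<le> avg_adoption P X n t"
proof -
  have "(\<Sum>j=1..n. c) \<le> (\<Sum>j=1..n. adoption_prob P X j t)"
    using assms by (intro sum_mono) auto
  then show ?thesis
    using assms(2) by (simp add: avg_adoption_def le_divide_eq mult.commute)
qed

lemma adoption_level_le_f_Bass:
  assumes p: "0 < p" and q: "0 < q" and t: "0 \<le> t"
    and mem: "(N, P, X) \<in> uniform_bass_models p q" and ex: "adoption_level_exists N P X t"
  shows "adoption_level N P X t \<le> f_Bass t p q"
proof -
  interpret uniform_bass_process P N X p q
    by (rule uniform_bass_modelsD[OF p q mem])
  have nonneg: "0 \<le> f_Bass t p q"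
    using bass_nonadoption_bounds[OF p q t] by (simp add: bass_nonadoption_def)
  have avg: "avg_adoption P X n t \<le> f_Bass t p q" if "enat n \<le> num_nodes N" for n
  proof (rule avg_adoption_le[OF adoption_prob_le_f_Bass[OF _ t] nonneg])
    fix j assume "j \<in> {1..n}"
    then show "j \<in> nodes N"
      using that by (auto simp: nodes_def intro: order_trans[of _ "enat n"])
  qed
  show ?thesis
  proof (cases "num_nodes N")
    case (enat n)
    then show ?thesis
      using avg[of n] by (simp add: adoption_level_def)
  next
    case infinity
    then have "(\<lambda>n. avg_adoption P X n t) \<longlonglongrightarrow> lim (\<lambda>n. avg_adoption P X n t)"
      using ex by (simp add: adoption_level_exists_def convergent_LIMSEQ_iff)
    then have "lim (\<lambda>n. avg_adoption P X n t) \<le> f_Bass t p q"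
      using avg infinity by (intro LIMSEQ_le_const2) auto
    then show ?thesis
      using infinity by (simp add: adoption_level_def)
  qed
qed

lemma cSup_eq_approx:
  fixes A :: "real set"
  assumes le: "\<And>x. x \<in> A \<Longrightarrow> x \<le> c" and approx: "\<And>e. 0 < e \<Longrightarrow> \<exists>x\<in>A. c - e \<le> x"
  shows "Sup A = c"
proof (rule antisym)
  have "A \<noteq> {}" using approx[of 1] by auto
  then show "Sup A \<le> c" by (rule cSup_least) (rule le)
  show "c \<le> Sup A"
  proof (rule field_le_epsilon)
    fix e :: real assume "0 < e"
    then obtain x where x: "x \<in> A" "c - e \<le> x" using approx by blast
    have "x \<le> Sup A"
      using x(1) le by (intro cSup_upper bdd_aboveI[of A c]) auto
    with x show "c \<le> Sup A + e" by simp
  qed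
qed

theorem lemma3:
  fixes p q t :: real
  assumes "p > 0" and "q > 0" and "t \<ge> 0"
  shows "Sup {adoption_level N P X t | N P X.
            (N, P, X) \<in> uniform_bass_models p q \<and> adoption_level_exists N P X t}
       = Sup {adoption_prob P X m t | N P X m.
            (N, P, X) \<in> uniform_bass_models p q \<and> m \<in> nodes N}
     \<and> Sup {adoption_prob P X m t | N P X m.
            (N, P, X) \<in> uniform_bass_models p q \<and> m \<in> nodes N}
       = f_Bass t p q"
proof -
  have prob: "Sup {adoption_prob P X m t | N P X m.
            (N, P, X) \<in> uniform_bass_models p q \<and> m \<in> nodes N} = f_Bass t p q"
  proof (rule cSup_eq_approx)
    fix x assume "x \<in> {adoption_prob P X m t | N P X m.
            (N, P, X) \<in> uniform_bass_models p q \<and> m \<in> nodes N}"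
    then show "x \<le> f_Bass t p q"
      using uniform_bass_process.adoption_prob_le_f_Bass[OF uniform_bass_modelsD[OF assms(1,2)] _ assms(3)]
      by auto
  next
    fix e :: real assume "0 < e"
    then obtain M P X where "2 \<le> M" "(complete_network p q M, P, X) \<in> uniform_bass_models p q"
      "\<And>j. j \<in> {1..M} \<Longrightarrow> f_Bass t p q - e \<le> adoption_prob P X j t"
      using f_Bass_approximated[OF assms] by metis
    then show "\<exists>x\<in>{adoption_prob P X m t | N P X m.
            (N, P, X) \<in> uniform_bass_models p q \<and> m \<in> nodes N}. f_Bass t p q - e \<le> x"
      by (intro bexI[of _ "adoption_prob P X 1 t"])
        (auto simp: nodes_complete_network intro!: exI[of _ "complete_network p q M"] exI[of _ P] exI[of _ X] exI[of _ "1::nat"])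
  qed
  have level: "Sup {adoption_level N P X t | N P X.
            (N, P, X) \<in> uniform_bass_models p q \<and> adoption_level_exists N P X t} = f_Bass t p q"
  proof (rule cSup_eq_approx)
    fix x assume "x \<in> {adoption_level N P X t | N P X.
            (N, P, X) \<in> uniform_bass_models p q \<and> adoption_level_exists N P X t}"
    then show "x \<le> f_Bass t p q"
      using adoption_level_le_f_Bass[OF assms] by auto
  next
    fix e :: real assume "0 < e"
    then obtain M P X where M: "2 \<le> M" and mem: "(complete_network p q M, P, X) \<in> uniform_bass_models p q"
      and ge: "\<And>j. j \<in> {1..M} \<Longrightarrow> f_Bass t p q - e \<le> adoption_prob P X j t"
      using f_Bass_approximated[OF assms] by metis
    let ?N = "complete_network p q M"
    have "num_nodes ?N = enat M" by (simp add: complete_network_def)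
    then have "adoption_level ?N P X t = avg_adoption P X M t" "adoption_level_exists ?N P X t"
      by (simp_all add: adoption_level_def adoption_level_exists_def)
    moreover have "f_Bass t p q - e \<le> avg_adoption P X M t"
      using M by (intro avg_adoption_ge ge) auto
    ultimately show "\<exists>x\<in>{adoption_level N P X t | N P X.
            (N, P, X) \<in> uniform_bass_models p q \<and> adoption_level_exists N P X t}. f_Bass t p q - e \<le> x"
      using mem by (intro bexI[of _ "adoption_level ?N P X t"] CollectI exI[of _ ?N] exI[of _ P] exI[of _ X]) auto
  qed
  show ?thesis
    using prob level by simp
qed

end
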